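(* Let $\mathbb{T}$ be a time scale, $a,b\in\mathbb{T}$ with $a<b$, and consider the optimal control problem $$J(x,u)=\int_a^b L(t,x(t),u(t))\,\Delta t\longrightarrow\min,\qquad x^{\Delta}(t)=\varphi(t,x(t),u(t)),\quad t\in[a,\rho(b)]_{\mathbb{T}},\qquad (P)$$ with $x\in C^1_{\mathrm{prd}}([a,b]_{\mathbb{T}})$ and $u\in C_{\mathrm{prd}}([a,\rho(b)]_{\mathbb{T}})$ real-valued, where $L,\varphi$ are defined for all $t\in\mathbb{R}$. Let $h_s=(h_s^t,h_s^x):[a,b]_{\mathbb{T}}\times\mathbb{R}^2\to\mathbb{R}^2$, $s\in(-\varepsilon,\varepsilon)$, be a one-parameter family of transformations and $\Phi_s(t,x,u)$ a family of functions, as specified in the context. Suppose problem $(P)$ is invariant under the transformation $h_s(t,x,u)$ up to $\Phi_s(t,x,u)$. Then along any extremal $(x,u,\lambda,p)$ of $(P)$, with $p_k$ the associated time-costate (defined in the context), $$\frac{\Delta}{\Delta t}\left[p_k(t)\frac{\partial}{\partial s}h_s^t(t,x(t),u(t))\Big|_{s=0}+p(t)\frac{\partial}{\partial s}h_s^x(t,x(t),u(t))\Big|_{s=0}+\lambda\frac{\partial}{\partial s}\Phi_s(t,x(t),u(t))\Big|_{s=0}\right]=0 .$$ Moreover, if $\rho\circ\sigma=\mathrm{id}_{[a,\rho(b)]_{\mathbb{T}}}$, then $$-H^\rho(t,x(t),u(t),\lambda,p(t))\frac{\partial}{\partial s}h_s^t(t,x(t),u(t))\Big|_{s=0}+p(t)\frac{\partial}{\partial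 s}h_s^x(t,x(t),u(t))\Big|_{s=0}+\lambda\frac{\partial}{\partial s}\Phi_s(t,x(t),u(t))\Big|_{s=0}$$ is constant in $t$ along any extremal $(x,u,\lambda,p)$ of $(P)$.
   Context: A time scale $\mathbb{T}$ is a nonempty closed subset of $\mathbb{R}$; $\sigma,\rho$ are its forward and backward jump operators, $\mu(t)=\sigma(t)-t$ its graininess, $f^\Delta$ (also written $\frac{\Delta}{\Delta t}f$) the delta derivative, $f^\sigma=f\circ\sigma$, $f^\rho=f\circ\rho$, and $\int\cdot\,\Delta t$ the delta integral. $[a,b]_{\mathbb{T}}:=[a,b]\cap\mathbb{T}$. For a time scale with maximum $b$, the superscript $\kappa$ means removing $(\rho(b),b]$. A function is rd-continuous if it is continuous at right-dense points and has left-sided limits at left-dense points; $C^1_{\mathrm{rd}}$ denotes functions with rd-continuous delta derivative. $C_{\mathrm{prd}}$ is the class of piecewise rd-continuous functions (rd-continuous except possibly at finitely many points), and $f\in C^1_{\mathrm{prd}}$ means that $f$ is continuous and $f^\Delta$ exists and is rd-continuous except possibly at finitely many points. Admissible pair: a pair $(x,u)$, with $x\in C^1_{\mathrm{prd}}([a,b]_{\mathbb{T}})$ and $u\in C_{\mathrm{prd}}([a,\rho(b)]_{\mathbb{T}})$, satisfying $x^\Delta(t)=\varphi(t,x(t),u(t))$ for $t\in[a,\rho(b)]_{\mathbb{T}}$. Regularity: $L(t,\cdot,\cdot)$ and $\varphi(t,\cdot,\cdot)$ are differentiable in $(x,u)$; $\frac{\partial L}{\partial x},\frac{\partial L}{\partial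 u},\frac{\partial\varphi}{\partial x},\frac{\partial\varphi}{\partial u}$ are continuous at $(x,u)$ uniformly in $t$ and rd-continuous in $t$ for any admissible $(x,u)$; $1+\mu(t)\frac{\partial\varphi}{\partial x}\neq0$ for all $t\in[a,\rho(b)]_{\mathbb{T}}$. Moreover $L,\varphi$ are differentiable jointly in $(t,x,u)$, $t\in\mathbb{R}$, so that the extremality conditions of the auxiliary problem below make sense. Extremal of $(P)$: a quadruple $(x,u,\lambda,p)$ with $(x,u)$ admissible, $\lambda\ge0$ a constant, $p\in C^1_{\mathrm{prd}}$ on $[a,\rho(b)]_{\mathbb{T}}$, such that for all $t\in[a,\rho(b)]_{\mathbb{T}}$ $$-p^\Delta=\frac{\partial\varphi}{\partial x}p^\sigma+\lambda\frac{\partial L}{\partial x},\qquad \frac{\partial\varphi}{\partial u}p^\sigma+\lambda\frac{\partial L}{\partial u}=0,$$ with partial derivatives evaluated at $(t,x(t),u(t))$. Hamiltonian: $H(t,x,u,\lambda,p)=\lambda L(t,x,u)+p^\sigma\varphi(t,x,u)$. $H^\rho$ along an extremal denotes the composition with $\rho$ of the function $t\mapsto\lambda L(t,x(t),u(t))+p^\sigma(t)\varphi(t,x(t),u(t))$. Time-costate $p_k$: consider the auxiliary problem of minimizing $\int_a^bL(k(t),x(t),u(t))r(t)\,\Delta t$ subject to $k^\Delta(t)=r(t)$, $x^\Delta(t)=\varphi(k(t),x(t),u(t))r(t)$, with states $(k,x)$ and controls $(r,u)$. The function $p_k\in C^1_{\mathrm{prd}}$ is the costate associated with $k$, i.e.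 $(k,x,r,u,\lambda,p_k,p)$ with $k(t)=t$, $r(t)=1$ is an extremal of the auxiliary problem. Explicitly, in addition to the two conditions above, for all $t\in[a,\rho(b)]_{\mathbb{T}}$, $$p_k^\Delta=-\lambda\frac{\partial L}{\partial t}-p^\sigma\frac{\partial\varphi}{\partial t},\qquad p_k^\sigma+\lambda L+p^\sigma\varphi=0,$$ evaluated at $(t,x(t),u(t))$. Family of transformations: $h_s^t,h_s^x$ have continuous partial delta derivatives of first and second order with respect to $s$ and $t$ for all admissible $(x,u)$ (i.e. after substituting $x=x(t),u=u(t)$; the derivative in the real parameter $s$ is the ordinary one), and $(h_0^t(t,x,u),h_0^x(t,x,u))=(t,x)$ for all $(t,x,u)\in[a,b]_{\mathbb{T}}\times\mathbb{R}^2$. For every admissible $(x,u)$ and all $s\in(-\varepsilon,\varepsilon)$, the map $\alpha(t):=h_s^t(t,x(t),u(t))=t_s$ on $[a,b]_{\mathbb{T}}$ is a strictly increasing $C^1_{\mathrm{rd}}$ function whose image is again a time scale, with forward jump $\bar\sigma$, graininess $\bar\mu$ and delta derivative $\bar\Delta$. Invariance: assume $1+\bar\mu(t_s)\frac{\partial\varphi}{\partial x}\neq0$ for all $t_s\in[h_s^t(a,x(a),u(a)),h_s^t(b,x(b),u(b))]^\kappa$ (in the image time scale). $(P)$ is invariant under $h_s$ up to $\Phi_s$ if $\Phi_s(t,x,u)$ has continuous partial delta derivatives of first and second order with respect to $s$ and $t$ for all admissible $(x,u)$, and for all $s\in(-\varepsilon,\varepsilon)$ and admissible $(x,u)$ there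 is a piecewise rd-continuous control $u_s(\cdot)$, defined on $\alpha([a,\rho(b)]_{\mathbb{T}})$, such that, writing $x_s(t_s):=h_s^x(t,x(t),u(t))$ for $t_s=\alpha(t)$, $$\int_{\alpha(a)}^{\alpha(\beta)}L(t_s,x_s(t_s),u_s(t_s))\,\bar\Delta t_s=\int_a^\beta\left(L(t,x(t),u(t))+\Phi_s^\Delta(t,x(t),u(t))\right)\Delta t\quad\text{for all }\beta\in[a,b]_{\mathbb{T}},$$ $$\frac{\bar\Delta}{\bar\Delta t_s}x_s(t_s)=\varphi(t_s,x_s(t_s),u_s(t_s)).$$ Here $\Phi_s^\Delta(t,x(t),u(t))$ is the delta derivative in $t$ of $t\mapsto\Phi_s(t,x(t),u(t))$. It is assumed that $u_0(\cdot)=u(\cdot)$ and that $\frac{\partial}{\partial s}(u_s\circ\alpha)\in C_{\mathrm{prd}}[a,\rho(b)]_{\mathbb{T}}$.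
   Formalization: Second claim: constancy is asserted only for t in σ([a,ρ(b)]), omitting a right-scattered a and left-dense right-scattered points, where it can fail; a time-costate p_k is assumed to exist there too. Piecewise rd-continuity includes finite one-sided limits. *)

theory Defs
  imports "HOL-Analysis.Analysis"
begin

section \<open>Time scales\<close>

definition time_scale :: "real set \<Rightarrow> bool" where
  "time_scale S \<longleftrightarrow> closed S \<and> S \<noteq> {}"

text \<open>
  The interval \<open>[a,b]\<close> of a time scale. It is a time scale itself, and all calculus on it is
  done with its own jump operators, so that \<open>\<sigma>(b) = b\<close> and \<open>\<rho>(a) = a\<close>.
\<close>

abbreviation ts_interval :: "real set \<Rightarrow> real \<Rightarrow> real \<Rightarrow> real set" where
  "ts_interval S c d \<equiv> S \<inter> {c..d}"

definition fwd :: "real set \<Rightarrow> real \<Rightarrow> real" where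
  "fwd S t = (if \<exists>s\<in>S. t < s then Inf {s \<in> S. t < s} else t)"

definition bwd :: "real set \<Rightarrow> real \<Rightarrow> real" where
  "bwd S t = (if \<exists>s\<in>S. s < t then Sup {s \<in> S. s < t} else t)"

definition graininess :: "real set \<Rightarrow> real \<Rightarrow> real" where
  "graininess S t = fwd S t - t"

definition right_scattered :: "real set \<Rightarrow> real \<Rightarrow> bool" where
  "right_scattered S t \<longleftrightarrow> t < fwd S t"

definition right_dense :: "real set \<Rightarrow> real \<Rightarrow> bool" where
  "right_dense S t \<longleftrightarrow> (\<exists>s\<in>S. t < s) \<and> fwd S t = t"

definition left_dense :: "real set \<Rightarrow> real \<Rightarrow> bool" where
  "left_dense S t \<longleftrightarrow> (\<exists>s\<in>S. s < t) \<and> bwd S t = t"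

text \<open>
  The superscript \<open>\<kappa>\<close>: if \<open>S\<close> has a maximum \<open>m\<close>, the points of \<open>(\<rho>(m),m]\<close> are removed.
  In particular \<open>kappa (ts_interval T a b)\<close> is \<open>[a,\<rho>(b)]\<close> in \<open>T\<close> (for \<open>a < b\<close> in \<open>T\<close>).
\<close>

definition kappa :: "real set \<Rightarrow> real set" where
  "kappa S = {t \<in> S. \<forall>m\<in>S. (\<forall>s\<in>S. s \<le> m) \<longrightarrow> t \<le> bwd S m}"

section \<open>Delta derivative and delta integral\<close>

definition has_delta_derivative ::
    "real set \<Rightarrow> (real \<Rightarrow> real) \<Rightarrow> real \<Rightarrow> real \<Rightarrow> bool" where
  "has_delta_derivative S f D t \<longleftrightarrow>
     (\<forall>\<eta>>0. \<exists>\<delta>>0. \<forall>s\<in>S. \<bar>s - t\<bar> < \<delta> \<longrightarrow>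
        \<bar>f (fwd S t) - f s - D * (fwd S t - s)\<bar> \<le> \<eta> * \<bar>fwd S t - s\<bar>)"

definition delta_differentiable :: "real set \<Rightarrow> (real \<Rightarrow> real) \<Rightarrow> real \<Rightarrow> bool" where
  "delta_differentiable S f t \<longleftrightarrow> (\<exists>D. has_delta_derivative S f D t)"

definition delta_deriv :: "real set \<Rightarrow> (real \<Rightarrow> real) \<Rightarrow> real \<Rightarrow> real" where
  "delta_deriv S f t = (SOME D. has_delta_derivative S f D t)"

text \<open>
  The Cauchy delta integral of Bohner and Peterson: \<open>F\<close> is a pre-antiderivative of \<open>f\<close> on
  \<open>[c,d]\<close>, i.e. continuous, with \<open>F\<^sup>\<Delta> = f\<close> outside a countable set without right-scattered points.
  Being a relation, it also says that the integral exists. Only used for \<open>c \<le> d\<close> in \<open>S\<close>.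
\<close>

definition has_delta_integral ::
    "real set \<Rightarrow> (real \<Rightarrow> real) \<Rightarrow> real \<Rightarrow> real \<Rightarrow> real \<Rightarrow> bool" where
  "has_delta_integral S f c d A \<longleftrightarrow>
     (\<exists>F N. countable N \<and> continuous_on (ts_interval S c d) F \<and>
        (\<forall>t\<in>N. \<not> right_scattered (ts_interval S c d) t) \<and>
        (\<forall>t\<in>kappa (ts_interval S c d) - N.
            has_delta_derivative (ts_interval S c d) F (f t) t) \<and>
        A = F d - F c)"

section \<open>Classes of functions\<close>

text \<open>
  Here \<open>S\<close> is the time scale and \<open>D\<close>, which is \<open>S\<close> or \<open>kappa S\<close>, the domain of the function.
\<close>

definition rd_continuous_at :: "real set \<Rightarrow> real set \<Rightarrow> (real \<Rightarrow> real) \<Rightarrow> real \<Rightarrow> bool" where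
  "rd_continuous_at S D f t \<longleftrightarrow>
     (right_dense S t \<longrightarrow> continuous (at t within D) f) \<and>
     (left_dense S t \<longrightarrow> (\<exists>l. (f \<longlongrightarrow> l) (at t within (D \<inter> {..<t}))))"

definition one_sided_limits_at :: "real set \<Rightarrow> real set \<Rightarrow> (real \<Rightarrow> real) \<Rightarrow> real \<Rightarrow> bool" where
  "one_sided_limits_at S D f t \<longleftrightarrow>
     (right_dense S t \<longrightarrow> (\<exists>l. (f \<longlongrightarrow> l) (at t within (D \<inter> {t<..})))) \<and>
     (left_dense S t \<longrightarrow> (\<exists>l. (f \<longlongrightarrow> l) (at t within (D \<inter> {..<t}))))"

text \<open>
  As usual for piecewise notions, finite one-sided limits are required at the finitely many
  exceptional points.
\<close>

definition C_prd :: "real set \<Rightarrow> real set \<Rightarrow> (real \<Rightarrow> real) \<Rightarrow> bool" where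
  "C_prd S D f \<longleftrightarrow>
     (\<exists>E. finite E \<and> (\<forall>t\<in>D - E. rd_continuous_at S D f t) \<and>
          (\<forall>t\<in>D \<inter> E. one_sided_limits_at S D f t))"

definition C1_rd :: "real set \<Rightarrow> (real \<Rightarrow> real) \<Rightarrow> bool" where
  "C1_rd S f \<longleftrightarrow>
     (\<forall>t\<in>kappa S. delta_differentiable S f t \<and>
                  rd_continuous_at S (kappa S) (delta_deriv S f) t)"

text \<open>
  The derivative need not exist at the exceptional points; the junk values that \<open>delta_deriv\<close>
  has there do not influence the limits at the other points, nor the one-sided limits.
\<close>

definition C1_prd :: "real set \<Rightarrow> (real \<Rightarrow> real) \<Rightarrow> bool" where
  "C1_prd S f \<longleftrightarrow>
     continuous_on S f \<and>
     (\<exists>E. finite E \<and> (\<forall>t\<in>kappa S - E. delta_differentiable S f t)) \<and>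
     C_prd S (kappa S) (delta_deriv S f)"

section \<open>The optimal control problem\<close>

definition pd_t :: "(real \<Rightarrow> real \<Rightarrow> real \<Rightarrow> real) \<Rightarrow> real \<Rightarrow> real \<Rightarrow> real \<Rightarrow> real" where
  "pd_t f t x u = deriv (\<lambda>r. f r x u) t"

definition pd_x :: "(real \<Rightarrow> real \<Rightarrow> real \<Rightarrow> real) \<Rightarrow> real \<Rightarrow> real \<Rightarrow> real \<Rightarrow> real" where
  "pd_x f t x u = deriv (\<lambda>y. f t y u) x"

definition pd_u :: "(real \<Rightarrow> real \<Rightarrow> real \<Rightarrow> real) \<Rightarrow> real \<Rightarrow> real \<Rightarrow> real \<Rightarrow> real" where
  "pd_u f t x u = deriv (\<lambda>v. f t x v) u"

text \<open>
  In the following, \<open>S\<close> is a time scale with minimum and maximum (\<open>[a,b]\<close> in \<open>T\<close>, or its image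
  under a transformation of time). The state of an admissible pair is only piecewise
  differentiable, so the dynamics is imposed at every point at which the derivative exists; the
  same convention applies to the costates. Right-scattered points are never exceptional, since a
  continuous function is delta differentiable there.
\<close>

definition admissible ::
    "(real \<Rightarrow> real \<Rightarrow> real \<Rightarrow> real) \<Rightarrow> real set \<Rightarrow> (real \<Rightarrow> real) \<Rightarrow> (real \<Rightarrow> real) \<Rightarrow> bool" where
  "admissible \<phi> S x u \<longleftrightarrow>
     C1_prd S x \<and> C_prd S (kappa S) u \<and>
     (\<forall>t\<in>kappa S. \<forall>D. has_delta_derivative S x D t \<longrightarrow> D = \<phi> t (x t) (u t))"

text \<open>
  Rd-continuity in \<open>t\<close> of a function \<open>g\<close> along \<open>(x,u)\<close> can only be expected where \<open>u\<close> itself is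
  rd-continuous.
\<close>

definition regular_along ::
    "real set \<Rightarrow> (real \<Rightarrow> real \<Rightarrow> real \<Rightarrow> real) \<Rightarrow> (real \<Rightarrow> real) \<Rightarrow> (real \<Rightarrow> real) \<Rightarrow> bool" where
  "regular_along S g x u \<longleftrightarrow>
     (\<forall>\<eta>>0. \<exists>\<delta>>0. \<forall>t\<in>kappa S. \<forall>y v. \<bar>y - x t\<bar> < \<delta> \<and> \<bar>v - u t\<bar> < \<delta> \<longrightarrow>
         \<bar>g t y v - g t (x t) (u t)\<bar> < \<eta>) \<and>
     (\<forall>t\<in>kappa S. rd_continuous_at S (kappa S) u t \<longrightarrow>
         rd_continuous_at S (kappa S) (\<lambda>r. g r (x r) (u r)) t)"

definition regular_problem ::
    "(real \<Rightarrow> real \<Rightarrow> real \<Rightarrow> real) \<Rightarrow> (real \<Rightarrow> real \<Rightarrow> real \<Rightarrow> real) \<Rightarrow> real set \<Rightarrow> bool" where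
  "regular_problem L \<phi> S \<longleftrightarrow>
     (\<forall>z. (\<lambda>(t, x, u). L t x u) differentiable (at z)) \<and>
     (\<forall>z. (\<lambda>(t, x, u). \<phi> t x u) differentiable (at z)) \<and>
     (\<forall>x u. admissible \<phi> S x u \<longrightarrow>
        regular_along S (pd_x L) x u \<and> regular_along S (pd_u L) x u \<and>
        regular_along S (pd_x \<phi>) x u \<and> regular_along S (pd_u \<phi>) x u \<and>
        (\<forall>t\<in>kappa S. 1 + graininess S t * pd_x \<phi> t (x t) (u t) \<noteq> 0))"

definition extremal ::
    "(real \<Rightarrow> real \<Rightarrow> real \<Rightarrow> real) \<Rightarrow> (real \<Rightarrow> real \<Rightarrow> real \<Rightarrow> real) \<Rightarrow> real set \<Rightarrow>
     (real \<Rightarrow> real) \<Rightarrow> (real \<Rightarrow> real) \<Rightarrow> real \<Rightarrow> (real \<Rightarrow> real) \<Rightarrow> bool" where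
  "extremal L \<phi> S x u \<Lambda> p \<longleftrightarrow>
     admissible \<phi> S x u \<and> \<Lambda> \<ge> 0 \<and> C1_prd S p \<and>
     (\<forall>t\<in>kappa S.
        (\<forall>D. has_delta_derivative S p D t \<longrightarrow>
           - D = pd_x \<phi> t (x t) (u t) * p (fwd S t) + \<Lambda> * pd_x L t (x t) (u t)) \<and>
        pd_u \<phi> t (x t) (u t) * p (fwd S t) + \<Lambda> * pd_u L t (x t) (u t) = 0)"

text \<open>
  For an extremal \<open>(x,u,\<Lambda>,p)\<close>, these are the further conditions which make \<open>(k,x,r,u,\<Lambda>,q,p)\<close> with
  \<open>k(t) = t\<close> and \<open>r = 1\<close> an extremal of the problem of minimizing the integral of \<open>L(k,x,u) r\<close> subject
  to \<open>k\<^sup>\<Delta> = r\<close>, \<open>x\<^sup>\<Delta> = \<phi>(k,x,u) r\<close>: the adjoint equation of \<open>k\<close> and stationarity in \<open>r\<close>.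
\<close>

definition time_costate ::
    "(real \<Rightarrow> real \<Rightarrow> real \<Rightarrow> real) \<Rightarrow> (real \<Rightarrow> real \<Rightarrow> real \<Rightarrow> real) \<Rightarrow> real set \<Rightarrow>
     (real \<Rightarrow> real) \<Rightarrow> (real \<Rightarrow> real) \<Rightarrow> real \<Rightarrow> (real \<Rightarrow> real) \<Rightarrow> (real \<Rightarrow> real) \<Rightarrow> bool" where
  "time_costate L \<phi> S x u \<Lambda> p q \<longleftrightarrow>
     C1_prd S q \<and>
     (\<forall>t\<in>kappa S.
        (\<forall>D. has_delta_derivative S q D t \<longrightarrow>
           D = - \<Lambda> * pd_t L t (x t) (u t) - p (fwd S t) * pd_t \<phi> t (x t) (u t)) \<and>
        q (fwd S t) + \<Lambda> * L t (x t) (u t) + p (fwd S t) * \<phi> t (x t) (u t) = 0)"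

text \<open>
  The function of \<open>t\<close> obtained from the Hamiltonian along \<open>(x,u,\<Lambda>,p)\<close>; \<open>H\<^sup>\<rho>\<close> is its composition with
  \<open>bwd S\<close>. Stationarity in \<open>r\<close> reads \<open>q(\<sigma>(t)) = - H(t)\<close>, so \<open>q = - H\<^sup>\<rho>\<close> is available on
  \<open>\<sigma>([a,\<rho>(b)])\<close>, where \<open>\<rho>\<close> is the inverse of \<open>\<sigma>\<close> if \<open>\<rho> \<circ> \<sigma> = id\<close> on \<open>[a,\<rho>(b)]\<close>. At a
  right-scattered \<open>a\<close>, and at left-dense right-scattered points, it fails in general.
\<close>

definition hamiltonian ::
    "(real \<Rightarrow> real \<Rightarrow> real \<Rightarrow> real) \<Rightarrow> (real \<Rightarrow> real \<Rightarrow> real \<Rightarrow> real) \<Rightarrow> real set \<Rightarrow>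
     (real \<Rightarrow> real) \<Rightarrow> (real \<Rightarrow> real) \<Rightarrow> real \<Rightarrow> (real \<Rightarrow> real) \<Rightarrow> real \<Rightarrow> real" where
  "hamiltonian L \<phi> S x u \<Lambda> p t = \<Lambda> * L t (x t) (u t) + p (fwd S t) * \<phi> t (x t) (u t)"

section \<open>Transformations and invariance\<close>

definition jointly_rd_continuous_at ::
    "real set \<Rightarrow> real set \<Rightarrow> real \<Rightarrow> (real \<Rightarrow> real \<Rightarrow> real) \<Rightarrow> real \<Rightarrow> real \<Rightarrow> bool" where
  "jointly_rd_continuous_at S D e G s t \<longleftrightarrow>
     (right_dense S t \<longrightarrow> continuous (at (s, t) within ({-e<..<e} \<times> D)) (\<lambda>(r, q). G r q)) \<and>
     (left_dense S t \<longrightarrow>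
        (\<exists>l. ((\<lambda>(r, q). G r q) \<longlongrightarrow> l) (at (s, t) within ({-e<..<e} \<times> (D \<inter> {..<t})))))"

text \<open>
  Existence and continuity of the partial derivatives of \<open>F s t\<close>, delta derivatives in \<open>t\<close> and
  ordinary ones in \<open>s\<close>: \<open>Fs\<close>, \<open>Fss\<close>, \<open>Ft\<close> and both mixed derivatives \<open>Fts\<close>, \<open>Fst\<close>. Since the
  families below contain the admissible states (\<open>F 0 = x\<close>), which are only piecewise smooth and
  have no second delta derivative in general, continuity of the delta derivatives means
  rd-continuity except at finitely many \<open>t\<close>, and no second delta derivative in \<open>t\<close> is required.
\<close>

definition smooth_family :: "real set \<Rightarrow> real \<Rightarrow> (real \<Rightarrow> real \<Rightarrow> real) \<Rightarrow> bool" where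
  "smooth_family S e F \<longleftrightarrow>
     (\<exists>Fs Fss Ft Fts Fst E. finite E \<and>
        (\<forall>s\<in>{-e<..<e}. continuous_on S (F s)) \<and>
        (\<forall>s\<in>{-e<..<e}. \<forall>t\<in>S.
           ((\<lambda>r. F r t) has_real_derivative Fs s t) (at s) \<and>
           ((\<lambda>r. Fs r t) has_real_derivative Fss s t) (at s)) \<and>
        continuous_on ({-e<..<e} \<times> S) (\<lambda>(s, t). Fs s t) \<and>
        continuous_on ({-e<..<e} \<times> S) (\<lambda>(s, t). Fss s t) \<and>
        (\<forall>s\<in>{-e<..<e}. \<forall>t\<in>kappa S - E.
           has_delta_derivative S (F s) (Ft s t) t \<and>
           ((\<lambda>r. Ft r t) has_real_derivative Fts s t) (at s) \<and>
           has_delta_derivative S (Fs s) (Fst s t) t \<and>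
           jointly_rd_continuous_at S (kappa S) e Ft s t \<and>
           jointly_rd_continuous_at S (kappa S) e Fts s t \<and>
           jointly_rd_continuous_at S (kappa S) e Fst s t))"

text \<open>
  Families \<open>h s t x u\<close>. Controls are functions on \<open>real\<close>, constrained only on \<open>kappa S\<close>; if the
  maximum \<open>b\<close> of \<open>S\<close> is left-scattered, \<open>u b\<close> is an arbitrary number.
\<close>

definition transformation_family ::
    "(real \<Rightarrow> real \<Rightarrow> real \<Rightarrow> real) \<Rightarrow> real set \<Rightarrow> real \<Rightarrow>
     (real \<Rightarrow> real \<Rightarrow> real \<Rightarrow> real \<Rightarrow> real) \<Rightarrow> (real \<Rightarrow> real \<Rightarrow> real \<Rightarrow> real \<Rightarrow> real) \<Rightarrow> bool" where
  "transformation_family \<phi> S e ht hx \<longleftrightarrow>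
     (\<forall>t\<in>S. \<forall>x u. ht 0 t x u = t \<and> hx 0 t x u = x) \<and>
     (\<forall>x u. admissible \<phi> S x u \<longrightarrow>
        smooth_family S e (\<lambda>s t. ht s t (x t) (u t)) \<and>
        smooth_family S e (\<lambda>s t. hx s t (x t) (u t)) \<and>
        (\<forall>s\<in>{-e<..<e}.
           strict_mono_on S (\<lambda>t. ht s t (x t) (u t)) \<and>
           C1_rd S (\<lambda>t. ht s t (x t) (u t)) \<and>
           time_scale ((\<lambda>t. ht s t (x t) (u t)) ` S)))"

text \<open>The transformed state \<open>x\<^sub>s\<close>, as a function of the new time \<open>t\<^sub>s\<close>:\<close>

definition transformed_state ::
    "real set \<Rightarrow> (real \<Rightarrow> real \<Rightarrow> real \<Rightarrow> real \<Rightarrow> real) \<Rightarrow>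
     (real \<Rightarrow> real \<Rightarrow> real \<Rightarrow> real \<Rightarrow> real) \<Rightarrow> (real \<Rightarrow> real) \<Rightarrow> (real \<Rightarrow> real) \<Rightarrow> real \<Rightarrow> real \<Rightarrow> real" where
  "transformed_state S ht hx x u s ts =
     (let t = the_inv_into S (\<lambda>t. ht s t (x t) (u t)) ts in hx s t (x t) (u t))"

text \<open>
  \<open>v s\<close> is the transformed control \<open>u\<^sub>s\<close>. The transformed dynamics is expressed by admissibility
  of \<open>(x\<^sub>s, u\<^sub>s)\<close> on the image time scale \<open>\<alpha> s ` S\<close>, whose \<open>kappa\<close> is \<open>\<alpha>([a,\<rho>(b)])\<close>.
  The parameter \<open>a\<close> is the minimum of \<open>S\<close>.
\<close>

definition invariant_up_to ::
    "(real \<Rightarrow> real \<Rightarrow> real \<Rightarrow> real) \<Rightarrow> (real \<Rightarrow> real \<Rightarrow> real \<Rightarrow> real) \<Rightarrow> real set \<Rightarrow> real \<Rightarrow> real \<Rightarrow>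
     (real \<Rightarrow> real \<Rightarrow> real \<Rightarrow> real \<Rightarrow> real) \<Rightarrow> (real \<Rightarrow> real \<Rightarrow> real \<Rightarrow> real \<Rightarrow> real) \<Rightarrow>
     (real \<Rightarrow> real \<Rightarrow> real \<Rightarrow> real \<Rightarrow> real) \<Rightarrow> bool" where
  "invariant_up_to L \<phi> S a e ht hx \<Phi> \<longleftrightarrow>
     (\<forall>x u. admissible \<phi> S x u \<longrightarrow>
        smooth_family S e (\<lambda>s t. \<Phi> s t (x t) (u t)) \<and>
        (\<exists>v :: real \<Rightarrow> real \<Rightarrow> real.
           let \<alpha> = (\<lambda>s t. ht s t (x t) (u t));
               y = transformed_state S ht hx x u
           in (\<forall>t\<in>kappa S. v 0 t = u t) \<and>
              (\<forall>s\<in>{-e<..<e}.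
                 admissible \<phi> (\<alpha> s ` S) (y s) (v s) \<and>
                 (\<forall>ts\<in>kappa (\<alpha> s ` S).
                    1 + graininess (\<alpha> s ` S) ts * pd_x \<phi> ts (y s ts) (v s ts) \<noteq> 0) \<and>
                 (\<forall>\<beta>\<in>S. \<exists>A.
                    has_delta_integral (\<alpha> s ` S) (\<lambda>ts. L ts (y s ts) (v s ts))
                      (\<alpha> s a) (\<alpha> s \<beta>) A \<and>
                    has_delta_integral S
                      (\<lambda>t. L t (x t) (u t) + delta_deriv S (\<lambda>r. \<Phi> s r (x r) (u r)) t)
                      a \<beta> A) \<and>
                 (\<forall>t\<in>kappa S. (\<lambda>r. v r (\<alpha> r t)) differentiable (at s)) \<and>
                 C_prd S (kappa S) (\<lambda>t. deriv (\<lambda>r. v r (\<alpha> r t)) s))))"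

end

theory Submission
  imports Defs
begin

text \<open>
  Write \<open>\<alpha>\<close>, \<open>\<zeta>\<close>, \<open>\<Psi>\<close> for the families \<open>h\<^sup>t\<close>, \<open>h\<^sup>x\<close>, \<open>\<Phi>\<close> along the extremal, \<open>\<tau>\<close>, \<open>\<xi>\<close>, \<open>\<psi>\<close> for
  their derivatives in the parameter at \<open>s = 0\<close>, \<open>v\<^sub>s\<close> for the transformed control, and \<open>w\<close> for the
  derivative of \<open>v\<^sub>s \<circ> \<alpha>\<^sub>s\<close> at \<open>s = 0\<close>. Pulled back to the original time scale, invariance says that
  \<open>\<zeta>\<^sub>s\<^sup>\<Delta> = \<phi>(\<alpha>\<^sub>s, \<zeta>\<^sub>s, v\<^sub>s \<circ> \<alpha>\<^sub>s) \<alpha>\<^sub>s\<^sup>\<Delta>\<close> and \<open>L(t, x, u) + \<Psi>\<^sub>s\<^sup>\<Delta> = L(\<alpha>\<^sub>s, \<zeta>\<^sub>s, v\<^sub>s \<circ> \<alpha>\<^sub>s) \<alpha>\<^sub>s\<^sup>\<Delta>\<close>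
  (\<open>delta_derivative_of_transformed_state\<close>, \<open>integrand_of_equal_delta_integrals\<close>). Since the delta
  derivative commutes with the derivative in \<open>s\<close> (\<open>smooth_family_variation\<close>), differentiating at
  \<open>s = 0\<close> gives
  \<open>\<xi>\<^sup>\<Delta> = \<phi>\<^sub>t \<tau> + \<phi>\<^sub>x \<xi> + \<phi>\<^sub>u w + \<phi> \<tau>\<^sup>\<Delta>\<close> and \<open>\<psi>\<^sup>\<Delta> = L\<^sub>t \<tau> + L\<^sub>x \<xi> + L\<^sub>u w + L \<tau>\<^sup>\<Delta>\<close>.
  Inserted into the product rule for \<open>C = q \<tau> + p \<xi> + \<Lambda> \<psi>\<close>, with \<open>q\<close> the time-costate, the adjoint
  equations and the two stationarity conditions make everything cancel.

  These identities hold outside exceptional sets only: the state and the costates are piecewise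
  smooth, and the integrals determine their integrands up to countable sets. Right-scattered
  points are never exceptional. As the exceptional sets depend on \<open>s\<close>, the identities are
  differentiated along a sequence \<open>s\<^sub>n \<longlonglongrightarrow> 0\<close>, so that \<open>C\<^sup>\<Delta> = 0\<close> holds outside a countable set
  without right-scattered points. A mean value inequality that tolerates such sets
  (\<open>delta_mean_value_inequality\<close>) shows that the continuous function \<open>C\<close> is constant, and hence that
  \<open>C\<^sup>\<Delta> = 0\<close> everywhere. If \<open>\<rho> \<circ> \<sigma> = id\<close>, stationarity in the speed of time turns \<open>q\<close> into
  \<open>- H\<^sup>\<rho>\<close> on the image of \<open>\<sigma>\<close>.
\<close>

section \<open>Jump operators\<close>

lemma fwd_ge: "t \<le> fwd S t"
proof (cases "\<exists>s\<in>S. t < s")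
  case True
  then have "{s \<in> S. t < s} \<noteq> {}" by auto
  then have "t \<le> Inf {s \<in> S. t < s}" by (rule cInf_greatest) auto
  then show ?thesis using True by (simp add: fwd_def)
qed (auto simp: fwd_def)

lemma fwd_le: "r \<in> S \<Longrightarrow> t < r \<Longrightarrow> fwd S t \<le> r"
proof -
  assume r: "r \<in> S" "t < r"
  have "bdd_below {s \<in> S. t < s}" by (rule bdd_belowI[of _ t]) simp
  then have "Inf {s \<in> S. t < s} \<le> r" using r by (intro cInf_lower) simp_all
  moreover have "\<exists>s\<in>S. t < s" using r by blast
  ultimately show ?thesis by (simp add: fwd_def)
qed

lemma fwd_approx:
  assumes "r \<in> S" "t < r" "\<delta> > 0"
  obtains s where "s \<in> S" "t < s" "s < fwd S t + \<delta>"
proof -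
  have "fwd S t = Inf {s \<in> S. t < s}" using assms by (auto simp: fwd_def)
  then have lt: "Inf {s \<in> S. t < s} < fwd S t + \<delta>" using assms by simp
  have ne: "{s \<in> S. t < s} \<noteq> {}" using assms by auto
  obtain s where "s \<in> {s \<in> S. t < s}" "s < fwd S t + \<delta>"
    using cInf_lessD[OF ne lt] by auto
  then show ?thesis by (intro that[of s]) simp_all
qed

lemma fwd_mem:
  assumes "closed S" "t \<in> S"
  shows "fwd S t \<in> S"
proof (cases "\<exists>s\<in>S. t < s")
  case True
  then have "Inf {s \<in> S. t < s} \<in> closure {s \<in> S. t < s}"
    by (intro closure_contains_Inf bdd_belowI[of _ t]) auto
  also have "\<dots> \<subseteq> closure S" by (rule closure_mono) auto
  finally show ?thesis using True assms by (simp add: fwd_def)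
next
  case False
  then show ?thesis using assms by (auto simp: fwd_def)
qed

lemma less_in_kappa:
  assumes "t \<in> S" "r \<in> S" "t < r"
  shows "t \<in> kappa S"
proof -
  have "t \<le> bwd S m" if "m \<in> S" "\<forall>s\<in>S. s \<le> m" for m
  proof -
    have "t < m" using that assms by force
    have "bdd_above {s \<in> S. s < m}" by (rule bdd_aboveI[of _ m]) simp
    then have "t \<le> Sup {s \<in> S. s < m}" using \<open>t < m\<close> assms(1) by (intro cSup_upper) simp_all
    moreover have "\<exists>s\<in>S. s < m" using \<open>t < m\<close> assms(1) by blast
    ultimately show ?thesis by (simp add: bwd_def)
  qed
  then show ?thesis using assms by (auto simp: kappa_def)
qed

lemma kappa_subset: "t \<in> kappa S \<Longrightarrow> t \<in> S"
  by (simp add: kappa_def)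

lemma not_right_scattered_iff: "\<not> right_scattered S t \<longleftrightarrow> fwd S t = t"
  using fwd_ge[of t S] by (auto simp: right_scattered_def)

lemma right_scattered_not_maximal:
  "right_scattered S t \<Longrightarrow> \<exists>r\<in>S. t < r"
  by (auto simp: right_scattered_def fwd_def split: if_splits)

lemma fwd_restrict:
  assumes "t \<in> S" "t < d" "c \<le> t" "d \<in> S"
  shows "fwd (S \<inter> {c..d}) t = fwd S t"
proof -
  have *: "\<exists>s\<in>S \<inter> {c..d}. t < s" "\<exists>s\<in>S. t < s" using assms by auto
  have "fwd (S \<inter> {c..d}) t \<le> fwd S t"
  proof (rule field_le_epsilon)
    fix e :: real assume "e > 0"
    then obtain s where s: "s \<in> S" "t < s" "s < fwd S t + e"
      using fwd_approx[of d S t e] assms by auto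
    have "fwd (S \<inter> {c..d}) t \<le> min s d"
      using s assms by (intro fwd_le) (auto simp: min_def)
    then show "fwd (S \<inter> {c..d}) t \<le> fwd S t + e" using s by simp
  qed
  moreover have "fwd S t \<le> fwd (S \<inter> {c..d}) t"
  proof (rule field_le_epsilon)
    fix e :: real assume "e > 0"
    then obtain s where s: "s \<in> S \<inter> {c..d}" "t < s" "s < fwd (S \<inter> {c..d}) t + e"
      using fwd_approx[of d "S \<inter> {c..d}" t e] assms by auto
    then show "fwd S t \<le> fwd (S \<inter> {c..d}) t + e"
      using fwd_le[of s S t] by auto
  qed
  ultimately show ?thesis by simp
qed

lemma fwd_image:
  assumes "closed S" "t \<in> S" "strict_mono_on S \<alpha>" "continuous_on S \<alpha>"
  shows "fwd (\<alpha> ` S) (\<alpha> t) = \<alpha> (fwd S t)"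
proof (cases "\<exists>r\<in>S. t < r")
  case False
  then have "\<forall>r\<in>S. r \<le> t" by force
  then have "\<forall>r\<in>S. \<alpha> r \<le> \<alpha> t"
    using assms(2,3) by (metis strict_mono_on_leD)
  then have "\<not> (\<exists>y\<in>\<alpha> ` S. \<alpha> t < y)" by force
  then show ?thesis using False by (auto simp: fwd_def)
next
  case True
  then obtain r0 where r0: "r0 \<in> S" "t < r0" by blast
  have mono: "\<alpha> x \<le> \<alpha> y" if "x \<in> S" "y \<in> S" "x \<le> y" for x y
    using that assms(3) by (metis strict_mono_on_leD)
  have smono: "\<alpha> x < \<alpha> y" if "x \<in> S" "y \<in> S" "x < y" for x y
    using that assms(3) by (auto simp: strict_mono_on_def)
  have sig: "fwd S t \<in> S" using assms fwd_mem by blast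
  have ar0: "\<alpha> r0 \<in> \<alpha> ` S" "\<alpha> t < \<alpha> r0" using r0 assms smono by auto
  have "\<alpha> (fwd S t) \<le> fwd (\<alpha> ` S) (\<alpha> t)"
  proof (rule field_le_epsilon)
    fix e :: real assume "e > 0"
    then obtain y where y: "y \<in> \<alpha> ` S" "\<alpha> t < y" "y < fwd (\<alpha> ` S) (\<alpha> t) + e"
      using fwd_approx[OF ar0] by metis
    then obtain r where r: "r \<in> S" "y = \<alpha> r" by auto
    have "t < r" using y r assms mono[of r t] by force
    then have "\<alpha> (fwd S t) \<le> y" using r sig mono fwd_le by auto
    then show "\<alpha> (fwd S t) \<le> fwd (\<alpha> ` S) (\<alpha> t) + e" using y by simp
  qed
  moreover have "fwd (\<alpha> ` S) (\<alpha> t) \<le> \<alpha> (fwd S t)"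
  proof (rule field_le_epsilon)
    fix e :: real assume e: "e > 0"
    obtain d where d: "d > 0" "\<And>r. r \<in> S \<Longrightarrow> \<bar>r - fwd S t\<bar> < d \<Longrightarrow> \<bar>\<alpha> r - \<alpha> (fwd S t)\<bar> < e"
      using assms(4) sig e unfolding continuous_on_iff dist_real_def by metis
    obtain r where r: "r \<in> S" "t < r" "r < fwd S t + d"
      using fwd_approx[OF r0 d(1)] by metis
    have "fwd S t \<le> r" using r fwd_le by auto
    then have "\<bar>\<alpha> r - \<alpha> (fwd S t)\<bar> < e" using d(2) r by auto
    moreover have "fwd (\<alpha> ` S) (\<alpha> t) \<le> \<alpha> r"
      using r assms smono by (intro fwd_le) auto
    ultimately show "fwd (\<alpha> ` S) (\<alpha> t) \<le> \<alpha> (fwd S t) + e" by linarith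
  qed
  ultimately show ?thesis by simp
qed

lemma right_scattered_image:
  assumes "closed S" "t \<in> S" "strict_mono_on S \<alpha>" "continuous_on S \<alpha>"
  shows "right_scattered (\<alpha> ` S) (\<alpha> t) \<longleftrightarrow> right_scattered S t"
  using assms fwd_mem[of S t]
  by (auto simp: right_scattered_def fwd_image strict_mono_on_less)

section \<open>Delta derivatives\<close>

text \<open>
  The difference quotient \<open>q\<close> towards \<open>\<sigma>(t)\<close>, completed by its limit, describes the delta
  derivative in the manner of Caratheodory. The rules of calculus then reduce to the
  continuity of sums, products and compositions.
\<close>

lemma has_delta_derivative_iff_slope:
  assumes "t \<in> S"
  shows "has_delta_derivative S f D t \<longleftrightarrow>
    (\<exists>q. (\<forall>s\<in>S. f (fwd S t) - f s = q s * (fwd S t - s)) \<and>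
         continuous (at t within S) q \<and> q t = D)" (is "?l \<longleftrightarrow> ?r")
proof
  assume l: ?l
  define q where "q s = (if s = fwd S t then D else (f (fwd S t) - f s) / (fwd S t - s))" for s
  have near: "\<exists>\<delta>>0. \<forall>s\<in>S. \<bar>s - t\<bar> < \<delta> \<longrightarrow> \<bar>q s - D\<bar> \<le> \<eta>" if \<eta>: "\<eta> > 0" for \<eta>
  proof -
    obtain \<delta> where \<delta>: "\<delta> > 0" "\<And>s. s \<in> S \<Longrightarrow> \<bar>s - t\<bar> < \<delta> \<Longrightarrow>
        \<bar>f (fwd S t) - f s - D * (fwd S t - s)\<bar> \<le> \<eta> * \<bar>fwd S t - s\<bar>"
      using l \<eta> unfolding has_delta_derivative_def by metis
    have "\<bar>q s - D\<bar> \<le> \<eta>" if s: "s \<in> S" "\<bar>s - t\<bar> < \<delta>" for s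
    proof (cases "s = fwd S t")
      case False
      then have "q s - D = (f (fwd S t) - f s - D * (fwd S t - s)) / (fwd S t - s)"
        by (simp add: q_def field_simps)
      then have "\<bar>q s - D\<bar> = \<bar>f (fwd S t) - f s - D * (fwd S t - s)\<bar> / \<bar>fwd S t - s\<bar>"
        by simp
      also have "\<dots> \<le> \<eta>" using \<delta>(2)[OF s] False by (simp add: field_simps)
      finally show ?thesis .
    qed (use \<open>\<eta> > 0\<close> in \<open>auto simp: q_def\<close>)
    then show ?thesis using \<delta>(1) by blast
  qed
  have qt: "q t = D"
  proof -
    have "\<bar>q t - D\<bar> \<le> 0 + \<eta>" if "\<eta> > 0" for \<eta>
    proof -
      obtain d where "d > 0" "\<forall>s\<in>S. \<bar>s - t\<bar> < d \<longrightarrow> \<bar>q s - D\<bar> \<le> \<eta>"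
        using near[OF \<open>\<eta> > 0\<close>] by auto
      then show ?thesis using assms by auto
    qed
    then have "\<bar>q t - D\<bar> \<le> 0" by (rule field_le_epsilon)
    then show ?thesis by simp
  qed
  have "continuous (at t within S) q"
    unfolding continuous_within_eps_delta dist_real_def qt
  proof (intro allI impI)
    fix e :: real assume "e > 0"
    then obtain d where "d > 0" "\<forall>s\<in>S. \<bar>s - t\<bar> < d \<longrightarrow> \<bar>q s - D\<bar> \<le> e/2"
      using near[of "e/2"] by auto
    then show "\<exists>d>0. \<forall>s\<in>S. \<bar>s - t\<bar> < d \<longrightarrow> \<bar>q s - D\<bar> < e"
      using \<open>e > 0\<close> by (intro exI[of _ d]) force
  qed
  then show ?r using qt by (intro exI[of _ q]) (auto simp: q_def)
next
  assume ?r
  then obtain q where q: "\<And>s. s \<in> S \<Longrightarrow> f (fwd S t) - f s = q s * (fwd S t - s)"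
    and cont: "continuous (at t within S) q" and D: "q t = D" by blast
  show ?l unfolding has_delta_derivative_def
  proof (intro allI impI)
    fix \<eta> :: real assume "\<eta> > 0"
    then obtain d where d: "d > 0" "\<And>s. s \<in> S \<Longrightarrow> \<bar>s - t\<bar> < d \<Longrightarrow> \<bar>q s - D\<bar> < \<eta>"
      using cont unfolding continuous_within_eps_delta dist_real_def D by metis
    have "\<bar>f (fwd S t) - f s - D * (fwd S t - s)\<bar> \<le> \<eta> * \<bar>fwd S t - s\<bar>"
      if "s \<in> S" "\<bar>s - t\<bar> < d" for s
    proof -
      have "f (fwd S t) - f s - D * (fwd S t - s) = (q s - D) * (fwd S t - s)"
        using q that by (simp add: algebra_simps)
      then show ?thesis using d(2)[OF that] by (simp add: abs_mult mult_right_mono)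
    qed
    then show "\<exists>\<delta>>0. \<forall>s\<in>S. \<bar>s - t\<bar> < \<delta> \<longrightarrow>
        \<bar>f (fwd S t) - f s - D * (fwd S t - s)\<bar> \<le> \<eta> * \<bar>fwd S t - s\<bar>" using d(1) by blast
  qed
qed

lemma has_delta_derivative_const:
  "t \<in> S \<Longrightarrow> has_delta_derivative S (\<lambda>_. k) 0 t"
  by (auto simp: has_delta_derivative_def intro!: exI[of _ 1])

lemma has_delta_derivative_linear:
  "t \<in> S \<Longrightarrow> has_delta_derivative S (\<lambda>r. k * r) k t"
  by (auto simp: has_delta_derivative_def algebra_simps intro!: exI[of _ 1])

lemma has_delta_derivative_add:
  assumes "t \<in> S" "has_delta_derivative S f D t" "has_delta_derivative S g D' t"
  shows "has_delta_derivative S (\<lambda>r. f r + g r) (D + D') t"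
proof -
  obtain q where "\<forall>s\<in>S. f (fwd S t) - f s = q s * (fwd S t - s)"
      "continuous (at t within S) q" "q t = D"
    using assms has_delta_derivative_iff_slope by blast
  moreover obtain q' where "\<forall>s\<in>S. g (fwd S t) - g s = q' s * (fwd S t - s)"
      "continuous (at t within S) q'" "q' t = D'"
    using assms has_delta_derivative_iff_slope by blast
  ultimately have "(\<forall>s\<in>S. f (fwd S t) + g (fwd S t) - (f s + g s) = (q s + q' s) * (fwd S t - s)) \<and>
      continuous (at t within S) (\<lambda>s. q s + q' s) \<and> q t + q' t = D + D'"
    by (simp add: continuous_add distrib_right add_diff_add)
  then show ?thesis unfolding has_delta_derivative_iff_slope[OF assms(1)]
    by (rule exI[of _ "\<lambda>s. q s + q' s"])
qed

lemma has_delta_derivative_cmult: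
  assumes "t \<in> S" "has_delta_derivative S f D t"
  shows "has_delta_derivative S (\<lambda>r. k * f r) (k * D) t"
proof -
  obtain q where "\<forall>s\<in>S. f (fwd S t) - f s = q s * (fwd S t - s)"
      "continuous (at t within S) q" "q t = D"
    using assms has_delta_derivative_iff_slope by blast
  then have "(\<forall>s\<in>S. k * f (fwd S t) - k * f s = k * q s * (fwd S t - s)) \<and>
      continuous (at t within S) (\<lambda>s. k * q s) \<and> k * q t = k * D"
    by (simp add: continuous_mult_left mult.assoc flip: right_diff_distrib)
  then show ?thesis unfolding has_delta_derivative_iff_slope[OF assms(1)]
    by (rule exI[of _ "\<lambda>s. k * q s"])
qed

lemma has_delta_derivative_diff:
  assumes "t \<in> S" "has_delta_derivative S f D t" "has_delta_derivative S g D' t"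
  shows "has_delta_derivative S (\<lambda>r. f r - g r) (D - D') t"
  using has_delta_derivative_add[OF assms(1,2) has_delta_derivative_cmult[OF assms(1,3), of "-1"]]
  by simp

lemma has_delta_derivative_mult:
  assumes "t \<in> S" "has_delta_derivative S f D t" "has_delta_derivative S g D' t"
    and "continuous (at t within S) g"
  shows "has_delta_derivative S (\<lambda>r. f r * g r) (D * g t + f (fwd S t) * D') t"
proof -
  obtain q where q: "\<forall>s\<in>S. f (fwd S t) - f s = q s * (fwd S t - s)"
      "continuous (at t within S) q" "q t = D"
    using assms has_delta_derivative_iff_slope by blast
  obtain q' where q': "\<forall>s\<in>S. g (fwd S t) - g s = q' s * (fwd S t - s)"
      "continuous (at t within S) q'" "q' t = D'"
    using assms has_delta_derivative_iff_slope by blast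
  have "f (fwd S t) * g (fwd S t) - f s * g s
      = (q s * g s + f (fwd S t) * q' s) * (fwd S t - s)" if "s \<in> S" for s
  proof -
    have "f (fwd S t) * g (fwd S t) - f s * g s
        = (f (fwd S t) - f s) * g s + f (fwd S t) * (g (fwd S t) - g s)"
      by (simp add: algebra_simps)
    then show ?thesis using q q' that by (simp add: algebra_simps)
  qed
  moreover have "continuous (at t within S) (\<lambda>s. q s * g s + f (fwd S t) * q' s)"
    by (intro continuous_intros q q' assms)
  ultimately show ?thesis unfolding has_delta_derivative_iff_slope[OF assms(1)]
    using q(3) q'(3) by (intro exI[of _ "\<lambda>s. q s * g s + f (fwd S t) * q' s"]) simp
qed

lemma has_delta_derivative_compose:
  assumes "closed S" "t \<in> S" "strict_mono_on S \<alpha>" "continuous_on S \<alpha>"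
    and "has_delta_derivative (\<alpha> ` S) y D (\<alpha> t)" "has_delta_derivative S \<alpha> A t"
  shows "has_delta_derivative S (\<lambda>r. y (\<alpha> r)) (D * A) t"
proof -
  note fw = fwd_image[OF assms(1-4)]
  obtain q where q: "\<forall>s\<in>S. \<alpha> (fwd S t) - \<alpha> s = q s * (fwd S t - s)"
      "continuous (at t within S) q" "q t = A"
    using assms has_delta_derivative_iff_slope by blast
  obtain q' where q': "\<forall>z\<in>\<alpha> ` S. y (\<alpha> (fwd S t)) - y z = q' z * (\<alpha> (fwd S t) - z)"
      "continuous (at (\<alpha> t) within \<alpha> ` S) q'" "q' (\<alpha> t) = D"
    using assms(2,5) has_delta_derivative_iff_slope[of "\<alpha> t" "\<alpha> ` S" y D] fw by auto
  have "continuous (at t within S) \<alpha>"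
    using assms by (simp add: continuous_on_eq_continuous_within)
  then have "continuous (at t within S) (q' \<circ> \<alpha>)"
    using q'(2) by (rule continuous_within_compose)
  then have "continuous (at t within S) (\<lambda>s. q' (\<alpha> s) * q s)"
    using continuous_mult[of "at t within S" "q' \<circ> \<alpha>" q] q(2) by (simp add: o_def)
  then show ?thesis unfolding has_delta_derivative_iff_slope[OF assms(2)]
    using q q' by (intro exI[of _ "\<lambda>s. q' (\<alpha> s) * q s"]) auto
qed

lemma has_delta_derivative_right_scattered:
  assumes "t \<in> S" "right_scattered S t" "continuous (at t within S) f"
  shows "has_delta_derivative S f ((f (fwd S t) - f t) / (fwd S t - t)) t"
proof -
  have "fwd S t - t \<noteq> 0" using assms by (simp add: right_scattered_def)
  then have "continuous (at t within S) (\<lambda>s. (f (fwd S t) - f s) / (fwd S t - s))"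
    by (intro continuous_intros assms)
  then show ?thesis
    unfolding has_delta_derivative_iff_slope[OF assms(1)]
    by (intro exI[of _ "\<lambda>s. (f (fwd S t) - f s) / (fwd S t - s)"]) simp
qed

lemma has_delta_derivative_increment:
  assumes "t \<in> S" "has_delta_derivative S f D t"
  shows "f (fwd S t) - f t = D * (fwd S t - t)"
  using assms unfolding has_delta_derivative_iff_slope[OF assms(1)] by auto

text \<open>
  Uniqueness fails at a left-scattered maximum: there \<open>\<sigma>(t) = t\<close> is isolated, and every number is a
  delta derivative.
\<close>

lemma has_delta_derivative_unique:
  assumes "t \<in> S" "r \<in> S" "t < r"
    and "has_delta_derivative S f D t" "has_delta_derivative S f D' t"
  shows "D = D'"
proof (cases "right_scattered S t")
  case True
  then show ?thesis
    using has_delta_derivative_increment[OF assms(1,4)] has_delta_derivative_increment[OF assms(1,5)]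
    by (auto simp: right_scattered_def)
next
  case False
  then have fw: "fwd S t = t" by (simp add: not_right_scattered_iff)
  obtain q where q: "\<And>s. s \<in> S \<Longrightarrow> f t - f s = q s * (t - s)"
      "continuous (at t within S) q" "q t = D"
    using assms has_delta_derivative_iff_slope fw by metis
  obtain q' where q': "\<And>s. s \<in> S \<Longrightarrow> f t - f s = q' s * (t - s)"
      "continuous (at t within S) q'" "q' t = D'"
    using assms has_delta_derivative_iff_slope fw by metis
  have lim: "((\<lambda>s. q s - q' s) \<longlongrightarrow> D - D') (at t within S)"
    using tendsto_diff[of q "q t" "at t within S" q' "q' t"] q(2,3) q'(2,3)
    by (simp add: continuous_within)
  have "((\<lambda>s. q s - q' s) \<longlongrightarrow> 0) (at t within S)"
  proof (rule tendsto_eventually)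
    have "q s = q' s" if "s \<in> S" "s \<noteq> t" for s
      using q(1)[of s] q'(1)[of s] that by auto
    then show "\<forall>\<^sub>F s in at t within S. q s - q' s = 0"
      by (auto simp: eventually_at_filter)
  qed
  moreover have "at t within S \<noteq> bot"
  proof -
    have "\<exists>s\<in>S. s \<noteq> t \<and> dist s t < e" if e: "e > 0" for e
    proof -
      obtain s where "s \<in> S" "t < s" "s < t + e"
        using fwd_approx[OF assms(2,3) e] unfolding fw by blast
      then show ?thesis by (auto simp: dist_real_def intro!: bexI[of _ s])
    qed
    then have "t islimpt S" by (auto simp: islimpt_approachable)
    then show ?thesis by (simp add: trivial_limit_within)
  qed
  ultimately have "D - D' = 0" using tendsto_unique[OF _ lim] by blast
  then show ?thesis by simp
qed

lemma delta_deriv_eq: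
  assumes "t \<in> S" "r \<in> S" "t < r" "has_delta_derivative S f D t"
  shows "delta_deriv S f t = D"
proof -
  have "has_delta_derivative S f (delta_deriv S f t) t"
    unfolding delta_deriv_def using assms(4) by (rule someI)
  then show ?thesis using has_delta_derivative_unique[OF assms(1-3)] assms(4) by blast
qed

lemma has_delta_derivative_cong:
  assumes "closed S" "t \<in> S" "\<And>s. s \<in> S \<Longrightarrow> f s = g s"
  shows "has_delta_derivative S f D t \<longleftrightarrow> has_delta_derivative S g D t"
  using fwd_mem[OF assms(1,2)]
  by (simp add: has_delta_derivative_def assms(3) cong: ball_cong)

lemma has_delta_derivative_restrict:
  assumes "has_delta_derivative S f D t" "t \<in> S" "c \<le> t" "t < d" "d \<in> S"
  shows "has_delta_derivative (S \<inter> {c..d}) f D t"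
proof -
  have fw: "fwd (S \<inter> {c..d}) t = fwd S t" using assms by (intro fwd_restrict)
  show ?thesis unfolding has_delta_derivative_def fw
  proof (intro allI impI)
    fix \<eta> :: real assume "\<eta> > 0"
    then obtain \<delta> where "\<delta> > 0" "\<forall>s\<in>S. \<bar>s - t\<bar> < \<delta> \<longrightarrow>
        \<bar>f (fwd S t) - f s - D * (fwd S t - s)\<bar> \<le> \<eta> * \<bar>fwd S t - s\<bar>"
      using assms(1)[unfolded has_delta_derivative_def, THEN spec, THEN mp, OF \<open>\<eta> > 0\<close>] by blast
    then show "\<exists>\<delta>>0. \<forall>s\<in>S \<inter> {c..d}. \<bar>s - t\<bar> < \<delta> \<longrightarrow>
        \<bar>f (fwd S t) - f s - D * (fwd S t - s)\<bar> \<le> \<eta> * \<bar>fwd S t - s\<bar>"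
      by (intro exI[of _ \<delta>]) simp
  qed
qed

text \<open>
  A continuous function has a delta derivative at every right-scattered point, so such points
  can be removed from the exceptional set.
\<close>

lemma C1_prd_differentiable:
  assumes "C1_prd S f"
  obtains E where "finite E" "\<And>t. t \<in> E \<Longrightarrow> \<not> right_scattered S t"
    "\<And>t. t \<in> kappa S \<Longrightarrow> t \<notin> E \<Longrightarrow> delta_differentiable S f t"
proof -
  obtain E where E: "finite E" "\<forall>t\<in>kappa S - E. delta_differentiable S f t"
    using assms unfolding C1_prd_def by meson
  have cont: "continuous_on S f" using assms unfolding C1_prd_def by meson
  have "delta_differentiable S f t" if "t \<in> kappa S" "t \<notin> {t\<in>E. \<not> right_scattered S t}" for t
  proof (cases "right_scattered S t")
    case True
    have tS: "t \<in> S" using that kappa_subset by blast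
    then have "continuous (at t within S) f"
      using cont by (simp add: continuous_on_eq_continuous_within)
    then show ?thesis
      using has_delta_derivative_right_scattered[OF tS True]
      by (auto simp: delta_differentiable_def)
  qed (use that E in auto)
  then show ?thesis using E(1) by (intro that[of "{t\<in>E. \<not> right_scattered S t}"]) simp_all
qed

section \<open>The mean value inequality\<close>

text \<open>
  The weight \<open>w\<close> jumps by a positive amount at each of countably many points \<open>q n\<close>: this is
  what absorbs the exceptional points in the mean value inequality.
\<close>

lemma jump_weight:
  fixes q :: "nat \<Rightarrow> real"
  shows "\<exists>w :: real \<Rightarrow> real. (\<forall>t. 0 \<le> w t) \<and> (\<forall>t. w t \<le> 2) \<and> mono w \<and>
    (\<forall>n t. q n < t \<longrightarrow> w (q n) + (1/2)^n \<le> w t)"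
proof -
  define g where "g t n = (if q n < t then (1/2)^n else (0::real))" for t n
  have geo: "(\<lambda>n. (1/2::real)^n) sums 2" using geometric_sums[of "1/2::real"] by simp
  have sm: "summable (g t)" for t
    by (rule summable_comparison_test'[of "\<lambda>n. (1/2::real)^n"])
      (use geo in \<open>auto simp: g_def sums_iff\<close>)
  have le: "suminf (g s) \<le> suminf (g t)" if "s \<le> t" for s t
    using that by (intro suminf_le sm) (auto simp: g_def)
  have jump: "suminf (g (q n)) + (1/2)^n \<le> suminf (g t)" if "q n < t" for n t
  proof -
    have one: "(\<lambda>k. if k = n then (1/2::real)^k else 0) sums (1/2)^n" by (rule sums_single)
    have "(\<lambda>k. g (q n) k + (if k = n then (1/2)^k else 0)) sums (suminf (g (q n)) + (1/2)^n)"
      by (intro sums_add summable_sums sm one)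
    moreover have "g t sums suminf (g t)" by (intro summable_sums sm)
    ultimately show ?thesis by (rule sums_le[rotated]) (use that in \<open>auto simp: g_def\<close>)
  qed
  have upper: "suminf (g t) \<le> 2" for t
    by (rule sums_le[OF _ summable_sums[OF sm] geo]) (auto simp: g_def)
  have lower: "0 \<le> suminf (g t)" for t
    by (rule suminf_nonneg[OF sm]) (auto simp: g_def)
  have "mono (\<lambda>t. suminf (g t))" using le by (simp add: mono_def)
  then show ?thesis using lower upper jump by (intro exI[of _ "\<lambda>t. suminf (g t)"]) blast
qed

text \<open>
  The bound \<open>f r - f c \<le> (M + \<eta>) (r - c) + \<eta> w r\<close> is propagated from \<open>c\<close> to \<open>d\<close>: at a
  right-scattered point by the jump, at an exceptional point by the jump of \<open>w\<close> and continuity,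
  elsewhere by the delta derivative. Then \<open>\<eta>\<close> tends to \<open>0\<close>.
\<close>

lemma delta_mean_value_inequality:
  fixes f :: "real \<Rightarrow> real"
  assumes "closed S" and c: "c \<in> S" and d: "d \<in> S" and "c \<le> d"
    and cont: "continuous_on (S \<inter> {c..d}) f"
    and "countable N"
    and N: "\<And>t. t \<in> N \<Longrightarrow> t \<in> S \<Longrightarrow> c \<le> t \<Longrightarrow> t < d \<Longrightarrow> \<not> right_scattered S t"
    and der: "\<And>t. t \<in> S \<Longrightarrow> c \<le> t \<Longrightarrow> t < d \<Longrightarrow> t \<notin> N \<Longrightarrow>
                \<exists>D\<le>M. has_delta_derivative S f D t"
  shows "f d - f c \<le> M * (d - c)"
proof -
  obtain q :: "nat \<Rightarrow> real" where q: "N \<subseteq> range q"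
    using subset_range_from_nat_into[OF \<open>countable N\<close>] by blast
  obtain w :: "real \<Rightarrow> real" where w0: "\<forall>t. 0 \<le> w t" and w2: "\<forall>t. w t \<le> 2" and wmono: "mono w"
    and jump: "\<forall>n t. q n < t \<longrightarrow> w (q n) + (1/2)^n \<le> w t"
    using jump_weight[of q] by blast
  have bound: "f d - f c \<le> (M + \<eta>) * (d - c) + \<eta> * w d" if \<eta>: "\<eta> > 0" for \<eta>
  proof -
    define P where "P r \<longleftrightarrow> f r - f c \<le> (M + \<eta>) * (r - c) + \<eta> * w r" for r
    define A where "A = {t\<in>S \<inter> {c..d}. \<forall>r\<in>S \<inter> {c..t}. P r}"
    have P_step: "P r'" if "P r" "f r' - f r \<le> (M + \<eta>) * (r' - r) + \<eta> * (w r' - w r)" for r r'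
      using that unfolding P_def by (simp add: algebra_simps)
    have cA: "c \<in> A" using c \<open>c \<le> d\<close> \<eta> w0 by (auto simp: A_def P_def)
    have bdd: "bdd_above A" by (auto simp: A_def intro: bdd_aboveI[of _ d])
    define m where "m = Sup A"
    have le_m: "t \<le> m" if "t \<in> A" for t using that bdd by (simp add: m_def cSup_upper)
    have m_cl: "m \<in> closure A"
      unfolding m_def using cA bdd by (intro closure_contains_Sup) auto
    let ?B = "{r \<in> S \<inter> {c..d}. f r - (M + \<eta>) * (r - c) - f c \<le> \<eta> * w m}"
    have "closed ?B"
      using cont \<open>closed S\<close>
      by (intro continuous_on_closed_Collect_le) (auto intro!: continuous_intros)
    moreover have "A \<subseteq> ?B"
    proof
      fix r assume r: "r \<in> A"
      then have "P r" by (auto simp: A_def)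
      moreover have "\<eta> * w r \<le> \<eta> * w m" using le_m[OF r] wmono \<eta> by (simp add: mono_def)
      ultimately have "f r - (M + \<eta>) * (r - c) - f c \<le> \<eta> * w m" by (simp add: P_def)
      then show "r \<in> ?B" using r by (simp add: A_def)
    qed
    ultimately have "m \<in> ?B" using m_cl closure_minimal by blast
    then have m: "m \<in> S" "c \<le> m" "m \<le> d" "P m" by (auto simp: P_def)
    have Pm: "P r" if r: "r \<in> S" "c \<le> r" "r \<le> m" for r
    proof (cases "r = m")
      case False
      then have "r < Sup A" using r by (simp add: m_def)
      then obtain t where "t \<in> A" "r < t" using less_cSupD[of A r] cA by auto
      then show ?thesis using r by (auto simp: A_def)
    qed (use m in simp)
    have "m = d"
    proof (rule ccontr)
      assume "m \<noteq> d"
      then have md: "m < d" using m by simp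
      \<comment> \<open>every case produces an element of \<open>A\<close> beyond \<open>m\<close>\<close>
      have extend: False if "r0 \<in> S" "m < r0" "r0 \<le> d"
        "\<And>r. r \<in> S \<Longrightarrow> m < r \<Longrightarrow> r \<le> r0 \<Longrightarrow> P r" for r0
      proof -
        have "P r" if "r \<in> S" "c \<le> r" "r \<le> r0" for r
          using that \<open>\<And>r. r \<in> S \<Longrightarrow> m < r \<Longrightarrow> r \<le> r0 \<Longrightarrow> P r\<close> Pm by (cases "r \<le> m") auto
        then have "r0 \<in> A" using that m by (auto simp: A_def)
        then show False using le_m that by force
      qed
      show False
      proof (cases "right_scattered S m")
        case True
        then have "m \<notin> N" using N m md by blast
        then obtain D where D: "D \<le> M" "has_delta_derivative S f D m" using der m md by blast
        let ?r = "fwd S m"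
        have r: "m < ?r" "?r \<in> S" "?r \<le> d"
          using True fwd_mem[OF \<open>closed S\<close>] fwd_le[OF d md] m by (auto simp: right_scattered_def)
        have "f ?r - f m = D * (?r - m)" using has_delta_derivative_increment D m by blast
        also have "\<dots> \<le> (M + \<eta>) * (?r - m)" using D \<eta> r by (intro mult_right_mono) auto
        also have "\<dots> \<le> (M + \<eta>) * (?r - m) + \<eta> * (w ?r - w m)"
          using wmono r \<eta> by (simp add: mono_def)
        finally have "P ?r" using P_step m by blast
        moreover have "r = ?r" if "r \<in> S" "m < r" "r \<le> ?r" for r
          using that fwd_le by force
        ultimately show False using extend r by metis
      next
        case False
        then have fw: "fwd S m = m" by (simp add: not_right_scattered_iff)
        have "\<exists>\<delta>>0. \<forall>r\<in>S. m < r \<longrightarrow> r \<le> d \<longrightarrow> r < m + \<delta> \<longrightarrow> P r"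
        proof (cases "m \<in> N")
          case True
          then obtain n where n: "m = q n" using q by auto
          have "0 < \<eta> * (1/2)^n" using \<eta> by simp
          moreover have "m \<in> S \<inter> {c..d}" using m by auto
          ultimately obtain \<delta> where \<delta>: "\<delta> > 0"
            "\<And>r. r \<in> S \<inter> {c..d} \<Longrightarrow> \<bar>r - m\<bar> < \<delta> \<Longrightarrow> \<bar>f r - f m\<bar> < \<eta> / 2 * (1/2)^n"
            using cont \<eta> unfolding continuous_on_iff dist_real_def
            by (metis half_gt_zero mult_pos_pos zero_less_divide_1_iff zero_less_numeral zero_less_power)
          \<comment> \<open>half of the jump of \<open>w\<close> absorbs \<open>f r - f m\<close>, the other half a negative \<open>M + \<eta>\<close>\<close>
          define K where "K = \<bar>M + \<eta>\<bar> + 1"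
          have K: "0 < K" "- (M + \<eta>) \<le> K" by (auto simp: K_def)
          define \<delta>' where "\<delta>' = min \<delta> (\<eta> / 2 * (1/2)^n / K)"
          have "\<delta>' > 0" using \<delta>(1) \<eta> K by (simp add: \<delta>'_def)
          moreover have "P r" if r: "r \<in> S" "m < r" "r \<le> d" "r < m + \<delta>'" for r
          proof -
            have 1: "\<bar>f r - f m\<bar> < \<eta> / 2 * (1/2)^n" using \<delta>(2)[of r] r m by (auto simp: \<delta>'_def)
            have "r - m < \<eta> / 2 * (1/2)^n / K" using r by (simp add: \<delta>'_def)
            then have "K * (r - m) < \<eta> / 2 * (1/2)^n"
              using K by (simp only: pos_less_divide_eq mult.commute[of K])
            moreover have "- (M + \<eta>) * (r - m) \<le> K * (r - m)"
              using r K by (intro mult_right_mono) auto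
            ultimately have 2: "- (M + \<eta>) * (r - m) \<le> \<eta> / 2 * (1/2)^n" by linarith
            have "(1/2)^n \<le> w r - w m" using jump r n by fastforce
            then have "\<eta> * (1/2)^n \<le> \<eta> * (w r - w m)" using \<eta> by simp
            then have "f r - f m \<le> (M + \<eta>) * (r - m) + \<eta> * (w r - w m)"
              using 1 2 by linarith
            then show ?thesis using P_step m by blast
          qed
          ultimately show ?thesis by blast
        next
          case notN: False
          then obtain D where D: "D \<le> M" "has_delta_derivative S f D m" using der m md by blast
          then obtain \<delta> where \<delta>: "\<delta> > 0" "\<And>s. s \<in> S \<Longrightarrow> \<bar>s - m\<bar> < \<delta> \<Longrightarrow>
              \<bar>f m - f s - D * (m - s)\<bar> \<le> \<eta> * \<bar>m - s\<bar>"
            using \<eta> unfolding has_delta_derivative_def fw by metis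
          have "P r" if r: "r \<in> S" "m < r" "r \<le> d" "r < m + \<delta>" for r
          proof -
            have "\<bar>f m - f r - D * (m - r)\<bar> \<le> \<eta> * (r - m)" using \<delta>(2)[of r] r by simp
            then have "f r - f m \<le> (D + \<eta>) * (r - m)" by (simp add: algebra_simps)
            also have "\<dots> \<le> (M + \<eta>) * (r - m)" using D r by (intro mult_right_mono) auto
            also have "\<dots> \<le> (M + \<eta>) * (r - m) + \<eta> * (w r - w m)"
              using wmono r \<eta> by (simp add: mono_def)
            finally show ?thesis using P_step m by blast
          qed
          then show ?thesis using \<delta>(1) by blast
        qed
        then obtain \<delta> where \<delta>: "\<delta> > 0" "\<And>r. r \<in> S \<Longrightarrow> m < r \<Longrightarrow> r \<le> d \<Longrightarrow> r < m + \<delta> \<Longrightarrow> P r"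
          by metis
        obtain r0 where r0: "r0 \<in> S" "m < r0" "r0 < m + min \<delta> (d - m)"
          using fwd_approx[OF d md, of "min \<delta> (d - m)"] \<delta>(1) md unfolding fw by auto
        then have "r0 \<le> d" "r0 < m + \<delta>" by simp_all
        then show False using r0 \<delta>(2) by (intro extend[of r0]) auto
      qed
    qed
    then show ?thesis using m by (simp add: P_def)
  qed
  show ?thesis
  proof (rule field_le_epsilon)
    fix e :: real assume "e > 0"
    define \<eta> where "\<eta> = e / (d - c + 2)"
    have \<eta>: "\<eta> > 0" "\<eta> * (d - c + 2) = e" using \<open>e > 0\<close> \<open>c \<le> d\<close> by (auto simp: \<eta>_def)
    have "\<eta> * w d \<le> \<eta> * 2" using w2 \<eta> by simp
    then show "f d - f c \<le> M * (d - c) + e"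
      using bound[OF \<eta>(1)] \<eta>(2) by (simp add: algebra_simps)
  qed
qed

lemma delta_mean_value_inequality_abs:
  fixes f :: "real \<Rightarrow> real"
  assumes "closed S" "c \<in> S" "d \<in> S" "c \<le> d"
    and cont: "continuous_on (S \<inter> {c..d}) f"
    and "countable N"
    and N: "\<And>t. t \<in> N \<Longrightarrow> t \<in> S \<Longrightarrow> c \<le> t \<Longrightarrow> t < d \<Longrightarrow> \<not> right_scattered S t"
    and der: "\<And>t. t \<in> S \<Longrightarrow> c \<le> t \<Longrightarrow> t < d \<Longrightarrow> t \<notin> N \<Longrightarrow>
                \<exists>D. \<bar>D\<bar> \<le> M \<and> has_delta_derivative S f D t"
  shows "\<bar>f d - f c\<bar> \<le> M * (d - c)"
proof -
  have "f d - f c \<le> M * (d - c)"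
  proof (rule delta_mean_value_inequality[OF assms(1-7)])
    fix t assume "t \<in> S" "c \<le> t" "t < d" "t \<notin> N"
    then show "\<exists>D\<le>M. has_delta_derivative S f D t" using der by (meson abs_le_D1)
  qed
  moreover have "- 1 * f d - - 1 * f c \<le> M * (d - c)"
  proof (rule delta_mean_value_inequality[OF assms(1-4) _ assms(6-7)])
    fix t assume t: "t \<in> S" "c \<le> t" "t < d" "t \<notin> N"
    then obtain D where "\<bar>D\<bar> \<le> M" "has_delta_derivative S f D t" using der by blast
    then show "\<exists>D\<le>M. has_delta_derivative S (\<lambda>x. - 1 * f x) D t"
      using has_delta_derivative_cmult[OF t(1), of f D "-1"] by (intro exI[of _ "-1 * D"]) auto
  qed (auto intro!: continuous_intros cont)
  ultimately show ?thesis by simp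
qed

lemma delta_derivative_zero_imp_eq:
  fixes f :: "real \<Rightarrow> real"
  assumes "closed S" "c \<in> S" "d \<in> S" "c \<le> d" "continuous_on (S \<inter> {c..d}) f" "countable N"
    and "\<And>t. t \<in> N \<Longrightarrow> t \<in> S \<Longrightarrow> c \<le> t \<Longrightarrow> t < d \<Longrightarrow> \<not> right_scattered S t"
    and "\<And>t. t \<in> S \<Longrightarrow> c \<le> t \<Longrightarrow> t < d \<Longrightarrow> t \<notin> N \<Longrightarrow> has_delta_derivative S f 0 t"
  shows "f d = f c"
proof -
  have "\<bar>f d - f c\<bar> \<le> 0 * (d - c)"
    by (rule delta_mean_value_inequality_abs[OF assms(1-7)]) (auto intro: assms(8))
  then show ?thesis by simp
qed

text \<open>Every pre-antiderivative on the whole time scale computes the integral up to each point.\<close>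

lemma has_delta_integral_eq_increment:
  assumes "closed S" "c \<in> S" "\<beta> \<in> S" "\<And>t. t \<in> S \<Longrightarrow> c \<le> t"
    and "continuous_on S F" "countable N" "\<And>t. t \<in> N \<Longrightarrow> \<not> right_scattered S t"
    and "\<And>t. t \<in> kappa S \<Longrightarrow> t \<notin> N \<Longrightarrow> has_delta_derivative S F (f t) t"
    and "has_delta_integral S f c \<beta> A"
  shows "A = F \<beta> - F c"
proof -
  let ?R = "S \<inter> {c..\<beta>}"
  obtain G N' where G: "countable N'" "continuous_on ?R G"
    "\<And>t. t \<in> N' \<Longrightarrow> \<not> right_scattered ?R t"
    "\<And>t. t \<in> kappa ?R - N' \<Longrightarrow> has_delta_derivative ?R G (f t) t" "A = G \<beta> - G c"
    using assms(9) unfolding has_delta_integral_def by metis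
  have fw: "fwd ?R t = fwd S t" if "t \<in> ?R" "t < \<beta>" for t
    using that assms by (intro fwd_restrict) auto
  have "F \<beta> - G \<beta> = F c - G c"
  proof (rule delta_derivative_zero_imp_eq[where f = "\<lambda>t. F t - G t" and d = \<beta> and c = c
        and S = ?R and N = "N \<union> N'"])
    fix t assume t: "t \<in> N \<union> N'" "t \<in> ?R" "c \<le> t" "t < \<beta>"
    have "right_scattered ?R t \<longleftrightarrow> right_scattered S t"
      using fw[OF t(2,4)] by (simp add: right_scattered_def)
    then show "\<not> right_scattered ?R t" using t(1) G(3) assms(7) by blast
  next
    fix t assume t: "t \<in> ?R" "c \<le> t" "t < \<beta>" "t \<notin> N \<union> N'"
    have "t \<in> kappa ?R" "t \<in> kappa S"
      using t less_in_kappa[of t ?R \<beta>] less_in_kappa[of t S \<beta>] assms by auto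
    then have "has_delta_derivative ?R G (f t) t" "has_delta_derivative ?R F (f t) t"
      using t G(4) assms by (auto intro!: has_delta_derivative_restrict)
    then show "has_delta_derivative ?R (\<lambda>t. F t - G t) 0 t"
      using has_delta_derivative_diff[OF t(1), of F "f t" G "f t"] by simp
  next
    show "continuous_on (?R \<inter> {c..\<beta>}) (\<lambda>t. F t - G t)"
      using G(2) assms(5) by (auto intro!: continuous_intros intro: continuous_on_subset)
  qed (use assms G in auto)
  then show ?thesis using G by simp
qed

section \<open>Differentiation with respect to the parameter\<close>

text \<open>
  The derivative in the parameter and the delta derivative commute at right-dense points: by the
  mean value inequality in \<open>t\<close> and the mean value theorem in \<open>s\<close>, the mixed second difference of
  \<open>F\<close> is close to \<open>h (d - c) Fts 0 t\<close>.
\<close>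

lemma has_delta_derivative_parameter_derivative:
  assumes "closed S" "t \<in> S" "fwd S t = t" "e > 0" "finite E" "t \<notin> E"
    and F: "\<And>s. s \<in> {-e<..<e} \<Longrightarrow> continuous_on S (F s)"
    and G: "\<And>q. q \<in> S \<Longrightarrow> ((\<lambda>s. F s q) has_real_derivative G q) (at 0)"
    and Ft: "\<And>s q. s \<in> {-e<..<e} \<Longrightarrow> q \<in> kappa S - E \<Longrightarrow> has_delta_derivative S (F s) (Ft s q) q"
    and Fts: "\<And>s q. s \<in> {-e<..<e} \<Longrightarrow> q \<in> kappa S - E \<Longrightarrow>
                ((\<lambda>r. Ft r q) has_real_derivative Fts s q) (at s)"
    and cont: "continuous (at (0, t) within ({-e<..<e} \<times> kappa S)) (\<lambda>(r, q). Fts r q)"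
  shows "has_delta_derivative S G (Fts 0 t) t"
  unfolding has_delta_derivative_def assms(3)
proof (intro allI impI)
  fix \<eta> :: real assume \<eta>: "\<eta> > 0"
  let ?A = "Fts 0 t"
  obtain d0 where d0: "d0 > 0"
    "\<forall>z\<in>{-e<..<e} \<times> kappa S. dist z (0, t) < d0 \<longrightarrow>
       dist (case z of (r, q) \<Rightarrow> Fts r q) (case (0, t) of (r, q) \<Rightarrow> Fts r q) < \<eta>"
    using cont[unfolded continuous_within_eps_delta, THEN spec, THEN mp, OF \<eta>] by blast
  have near: "\<bar>Fts r q - ?A\<bar> \<le> \<eta>"
    if "r \<in> {-e<..<e}" "q \<in> kappa S" "\<bar>r\<bar> < d0/2" "\<bar>q - t\<bar> < d0/2" for r q
  proof -
    have "dist (r, q) (0, t) = sqrt (\<bar>r\<bar>^2 + \<bar>q - t\<bar>^2)"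
      by (simp add: dist_Pair_Pair dist_real_def)
    also have "\<dots> \<le> \<bar>r\<bar> + \<bar>q - t\<bar>" by (rule sqrt_sum_squares_le_sum) auto
    finally have "dist (r, q) (0, t) < d0" using that by simp
    then show ?thesis using d0(2)[rule_format, of "(r, q)"] that by (simp add: dist_real_def)
  qed
  obtain d1 where d1: "d1 > 0" "\<forall>q\<in>E. q \<noteq> t \<longrightarrow> d1 \<le> dist t q"
    using finite_set_avoid[OF \<open>finite E\<close>] by blast
  define \<delta> where "\<delta> = min (d0/2) d1"
  have \<delta>: "\<delta> > 0" using d0 d1 by (simp add: \<delta>_def)
  have key: "\<bar>G d - G c - ?A * (d - c)\<bar> \<le> \<eta> * (d - c)"
    if cd: "c \<in> S" "d \<in> S" "c \<le> d" "\<bar>c - t\<bar> < \<delta>" "\<bar>d - t\<bar> < \<delta>" for c d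
  proof -
    have quot: "\<bar>(F h d - F 0 d) / h - (F h c - F 0 c) / h - ?A * (d - c)\<bar> \<le> \<eta> * (d - c)"
      if h: "0 < h" "h < min e (d0/2)" for h
    proof -
      \<comment> \<open>the increment of \<open>f\<close> is the mixed second difference minus \<open>h Fts 0 t (d - c)\<close>\<close>
      define f where "f q = F h q - F 0 q - h * ?A * q" for q
      have "\<bar>f d - f c\<bar> \<le> (\<eta> * h) * (d - c)"
      proof (rule delta_mean_value_inequality_abs[where f = f and d = d and c = c and N = "{}" and S = S])
        have "continuous_on (S \<inter> {c..d}) (F s)" if "s \<in> {-e<..<e}" for s
          using F[OF that] by (rule continuous_on_subset) auto
        then show "continuous_on (S \<inter> {c..d}) f"
          unfolding f_def using h \<open>e > 0\<close> by (intro continuous_intros) auto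
      next
        fix q assume q: "q \<in> S" "c \<le> q" "q < d" "q \<notin> {}"
        have qt: "\<bar>q - t\<bar> < \<delta>" using q cd by linarith
        have "q \<notin> E"
        proof
          assume "q \<in> E"
          then have "d1 \<le> \<bar>q - t\<bar>"
            using d1(2) \<open>t \<notin> E\<close> by (auto simp: dist_real_def abs_minus_commute)
          then show False using qt by (simp add: \<delta>_def)
        qed
        then have qk: "q \<in> kappa S - E" using less_in_kappa[OF q(1) cd(2) q(3)] by simp
        have "\<exists>z>0. z < h \<and> Ft h q - Ft 0 q = (h - 0) * Fts z q"
          using h by (intro MVT2 Fts qk) auto
        then obtain z where z: "0 < z" "z < h" "Ft h q - Ft 0 q = h * Fts z q" by auto
        have "Ft h q - Ft 0 q - h * ?A = h * (Fts z q - ?A)"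
          unfolding z(3) by (simp add: right_diff_distrib)
        moreover have "\<bar>Fts z q - ?A\<bar> \<le> \<eta>"
          using z h qt qk \<open>e > 0\<close> by (intro near) (auto simp: \<delta>_def)
        ultimately have "\<bar>Ft h q - Ft 0 q - h * ?A\<bar> \<le> \<eta> * h"
          using h by (simp add: abs_mult mult.commute)
        moreover have "has_delta_derivative S f (Ft h q - Ft 0 q - h * ?A) q"
          unfolding f_def using h \<open>e > 0\<close>
          by (intro has_delta_derivative_diff has_delta_derivative_linear Ft q qk) auto
        ultimately show "\<exists>D. \<bar>D\<bar> \<le> \<eta> * h \<and> has_delta_derivative S f D q" by blast
      qed (use cd assms(1) in auto)
      moreover have "f d - f c
          = ((F h d - F 0 d) / h - (F h c - F 0 c) / h - ?A * (d - c)) * h"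
        using h by (simp add: f_def field_simps)
      ultimately have "\<bar>(F h d - F 0 d) / h - (F h c - F 0 c) / h - ?A * (d - c)\<bar> * h
          \<le> (\<eta> * (d - c)) * h"
        using h by (simp add: abs_mult mult.assoc mult.commute[of h])
      then show ?thesis using h by (simp only: mult_le_cancel_right_pos)
    qed
    have lim: "((\<lambda>h. (F h q - F 0 q) / h) \<longlongrightarrow> G q) (at_right 0)" if "q \<in> S" for q
      using G[OF that] unfolding DERIV_def by (simp add: filterlim_at_split)
    have "((\<lambda>h. \<bar>(F h d - F 0 d) / h - (F h c - F 0 c) / h - ?A * (d - c)\<bar>)
        \<longlongrightarrow> \<bar>G d - G c - ?A * (d - c)\<bar>) (at_right 0)"
      by (intro tendsto_intros lim cd)
    moreover have "eventually (\<lambda>h. \<bar>(F h d - F 0 d) / h - (F h c - F 0 c) / h - ?A * (d - c)\<bar>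
        \<le> \<eta> * (d - c)) (at_right 0)"
      unfolding eventually_at_right_field using quot \<open>e > 0\<close> d0(1)
      by (intro exI[of _ "min e (d0/2)"]) simp
    ultimately show ?thesis by (rule tendsto_upperbound) simp
  qed
  have "\<bar>G t - G s - ?A * (t - s)\<bar> \<le> \<eta> * \<bar>t - s\<bar>" if s: "s \<in> S" "\<bar>s - t\<bar> < \<delta>" for s
  proof (cases "s \<le> t")
    case True
    then show ?thesis using key[of s t] s \<open>t \<in> S\<close> \<delta> by simp
  next
    case False
    have "G t - G s - ?A * (t - s) = - (G s - G t - ?A * (s - t))" by (simp add: algebra_simps)
    then have "\<bar>G t - G s - ?A * (t - s)\<bar> = \<bar>G s - G t - ?A * (s - t)\<bar>"
      by (simp only: abs_minus_cancel)
    then show ?thesis using key[of t s] s \<open>t \<in> S\<close> \<delta> False by simp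
  qed
  then show "\<exists>\<delta>>0. \<forall>s\<in>S. \<bar>s - t\<bar> < \<delta> \<longrightarrow> \<bar>G t - G s - ?A * (t - s)\<bar> \<le> \<eta> * \<bar>t - s\<bar>"
    using \<delta> by blast
qed

text \<open>
  The first variation of a smooth family. At a right-scattered point everything follows from
  the difference quotient, so no such point is exceptional.
\<close>

lemma smooth_family_variation:
  assumes S: "closed S" and e: "e > 0" and sf: "smooth_family S e F"
  defines "G \<equiv> \<lambda>t. deriv (\<lambda>s. F s t) 0"
  shows "continuous_on S G"
    and "t \<in> S \<Longrightarrow> ((\<lambda>s. F s t) has_real_derivative G t) (at 0)"
    and "\<exists>E. finite E \<and> (\<forall>t\<in>E. \<not> right_scattered S t) \<and>
      (\<forall>t\<in>kappa S - E. (\<exists>r\<in>S. t < r) \<longrightarrow>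
        (\<exists>D. (\<forall>s\<in>{-e<..<e}. has_delta_derivative S (F s) (delta_deriv S (F s) t) t) \<and>
             ((\<lambda>s. delta_deriv S (F s) t) has_real_derivative D) (at 0) \<and>
             has_delta_derivative S G D t))"
proof -
  obtain Fs Fss Ft Fts Fst E where E: "finite E"
    and F: "\<forall>s\<in>{-e<..<e}. continuous_on S (F s)"
    and Fs: "\<forall>s\<in>{-e<..<e}. \<forall>t\<in>S.
           ((\<lambda>r. F r t) has_real_derivative Fs s t) (at s) \<and>
           ((\<lambda>r. Fs r t) has_real_derivative Fss s t) (at s)"
    and Fs_cont: "continuous_on ({-e<..<e} \<times> S) (\<lambda>(s, t). Fs s t)"
    and Ft: "\<forall>s\<in>{-e<..<e}. \<forall>t\<in>kappa S - E.
           has_delta_derivative S (F s) (Ft s t) t \<and>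
           ((\<lambda>r. Ft r t) has_real_derivative Fts s t) (at s) \<and>
           has_delta_derivative S (Fs s) (Fst s t) t \<and>
           jointly_rd_continuous_at S (kappa S) e Ft s t \<and>
           jointly_rd_continuous_at S (kappa S) e Fts s t \<and>
           jointly_rd_continuous_at S (kappa S) e Fst s t"
    using sf unfolding smooth_family_def by (elim exE conjE) (rule that; assumption)
  have zero: "0 \<in> {-e<..<e}" using e by simp
  have G_eq: "G t = Fs 0 t" if "t \<in> S" for t
    using Fs zero that unfolding G_def by (intro DERIV_imp_deriv) blast
  show G: "((\<lambda>s. F s t) has_real_derivative G t) (at 0)" if "t \<in> S" for t
    using Fs zero that G_eq by simp
  have "continuous_on S (\<lambda>t. (\<lambda>(s, t). Fs s t) (0, t))"
    by (rule continuous_on_compose2[OF Fs_cont]) (use zero in \<open>auto intro!: continuous_intros\<close>)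
  then show G_cont: "continuous_on S G"
    by (simp add: continuous_on_cong[OF refl G_eq])
  let ?E = "{t\<in>E. \<not> right_scattered S t}"
  have main: "\<exists>D. (\<forall>s\<in>{-e<..<e}. has_delta_derivative S (F s) (delta_deriv S (F s) t) t) \<and>
             ((\<lambda>s. delta_deriv S (F s) t) has_real_derivative D) (at 0) \<and>
             has_delta_derivative S G D t"
    if t: "t \<in> kappa S" "t \<notin> ?E" and r: "r \<in> S" "t < r" for t r
  proof -
    have tS: "t \<in> S" using t kappa_subset by blast
    show ?thesis
    proof (cases "right_scattered S t")
      case True
      let ?\<sigma> = "fwd S t"
      have \<sigma>: "?\<sigma> \<in> S" using S tS fwd_mem by blast
      have at: "continuous (at t within S) f" if "continuous_on S f" for f :: "real \<Rightarrow> real"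
        using that tS by (simp add: continuous_on_eq_continuous_within)
      have Fd: "has_delta_derivative S (F s) ((F s ?\<sigma> - F s t) / (?\<sigma> - t)) t"
        if "s \<in> {-e<..<e}" for s
        using F that by (intro has_delta_derivative_right_scattered tS True at) blast
      then have eq: "delta_deriv S (F s) t = (F s ?\<sigma> - F s t) / (?\<sigma> - t)"
        if "s \<in> {-e<..<e}" for s
        using delta_deriv_eq[OF tS r] that by blast
      have "((\<lambda>s. (F s ?\<sigma> - F s t) / (?\<sigma> - t)) has_real_derivative (G ?\<sigma> - G t) / (?\<sigma> - t)) (at 0)"
        by (intro DERIV_cdivide DERIV_diff G \<sigma> tS)
      then have "((\<lambda>s. delta_deriv S (F s) t) has_real_derivative (G ?\<sigma> - G t) / (?\<sigma> - t)) (at 0)"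
        by (rule has_field_derivative_transform_within_open[where S = "{-e<..<e}"])
          (use zero eq in auto)
      moreover have "has_delta_derivative S G ((G ?\<sigma> - G t) / (?\<sigma> - t)) t"
        by (intro has_delta_derivative_right_scattered tS True at G_cont)
      moreover have "\<forall>s\<in>{-e<..<e}. has_delta_derivative S (F s) (delta_deriv S (F s) t) t"
        using Fd eq by simp
      ultimately show ?thesis by blast
    next
      case False
      then have fw: "fwd S t = t" and tE: "t \<notin> E" and tk: "t \<in> kappa S - E"
        using t by (auto simp: not_right_scattered_iff)
      have rd: "right_dense S t" using fw r by (auto simp: right_dense_def)
      have Ftd: "has_delta_derivative S (F s) (Ft s t) t" if "s \<in> {-e<..<e}" for s
        using Ft that tk by blast
      then have eq: "delta_deriv S (F s) t = Ft s t" if "s \<in> {-e<..<e}" for s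
        using delta_deriv_eq[OF tS r] that by blast
      have "((\<lambda>s. Ft s t) has_real_derivative Fts 0 t) (at 0)" using Ft zero tk by blast
      then have "((\<lambda>s. delta_deriv S (F s) t) has_real_derivative Fts 0 t) (at 0)"
        by (rule has_field_derivative_transform_within_open[where S = "{-e<..<e}"])
          (use zero eq in auto)
      moreover have "has_delta_derivative S G (Fts 0 t) t"
      proof (rule has_delta_derivative_parameter_derivative[where E = E and F = F and Ft = Ft])
        have "jointly_rd_continuous_at S (kappa S) e Fts 0 t" using Ft zero tk by blast
        then show "continuous (at (0, t) within ({-e<..<e} \<times> kappa S)) (\<lambda>(r, q). Fts r q)"
          using rd by (simp add: jointly_rd_continuous_at_def)
      qed (use S tS fw e E tE F G Ft in blast)+
      moreover have "\<forall>s\<in>{-e<..<e}. has_delta_derivative S (F s) (delta_deriv S (F s) t) t"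
        using Ftd eq by simp
      ultimately show ?thesis by blast
    qed
  qed
  show "\<exists>E. finite E \<and> (\<forall>t\<in>E. \<not> right_scattered S t) \<and>
      (\<forall>t\<in>kappa S - E. (\<exists>r\<in>S. t < r) \<longrightarrow>
        (\<exists>D. (\<forall>s\<in>{-e<..<e}. has_delta_derivative S (F s) (delta_deriv S (F s) t) t) \<and>
             ((\<lambda>s. delta_deriv S (F s) t) has_real_derivative D) (at 0) \<and>
             has_delta_derivative S G D t))"
    using E main by (intro exI[of _ ?E]) auto
qed

lemma has_real_derivative_along_curve:
  fixes f :: "real \<Rightarrow> real \<Rightarrow> real \<Rightarrow> real"
  assumes diff: "(\<lambda>(t, x, u). f t x u) differentiable (at (a r, y r, w r))"
    and a: "(a has_real_derivative a') (at r)"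
    and y: "(y has_real_derivative y') (at r)"
    and w: "(w has_real_derivative w') (at r)"
  shows "((\<lambda>s. f (a s) (y s) (w s)) has_real_derivative
    pd_t f (a r) (y r) (w r) * a' + pd_x f (a r) (y r) (w r) * y' + pd_u f (a r) (y r) (w r) * w')
    (at r)"
proof -
  obtain f' where f': "((\<lambda>(t, x, u). f t x u) has_derivative f') (at (a r, y r, w r))"
    using diff by (auto simp: differentiable_def)
  interpret f': bounded_linear f' using f' by (rule has_derivative_bounded_linear)
  have chain: "((\<lambda>s. f (\<alpha> s) (\<eta> s) (\<omega> s)) has_real_derivative f' (\<alpha>', \<eta>', \<omega>')) (at s0)"
    if "(\<alpha> has_real_derivative \<alpha>') (at s0)" "(\<eta> has_real_derivative \<eta>') (at s0)"
      "(\<omega> has_real_derivative \<omega>') (at s0)" "\<alpha> s0 = a r" "\<eta> s0 = y r" "\<omega> s0 = w r"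
    for \<alpha> \<eta> \<omega> \<alpha>' \<eta>' \<omega>' s0
  proof -
    have "((\<lambda>s. (\<alpha> s, \<eta> s, \<omega> s)) has_derivative (\<lambda>h. (\<alpha>' * h, \<eta>' * h, \<omega>' * h))) (at s0)"
      using that by (intro has_derivative_Pair) (simp_all add: has_field_derivative_def)
    then have "((\<lambda>s. (\<lambda>(t, x, u). f t x u) (\<alpha> s, \<eta> s, \<omega> s)) has_derivative
        (\<lambda>h. f' (\<alpha>' * h, \<eta>' * h, \<omega>' * h))) (at s0)"
      by (rule has_derivative_compose) (use f' that in simp)
    moreover have "f' (\<alpha>' * h, \<eta>' * h, \<omega>' * h) = f' (\<alpha>', \<eta>', \<omega>') * h" for h
      using f'.scaleR[of h "(\<alpha>', \<eta>', \<omega>')"] by (simp add: mult.commute)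
    ultimately show ?thesis by (simp add: has_field_derivative_def)
  qed
  have "pd_t f (a r) (y r) (w r) = f' (1, 0, 0)"
    unfolding pd_t_def by (intro DERIV_imp_deriv chain) (auto intro!: derivative_intros)
  moreover have "pd_x f (a r) (y r) (w r) = f' (0, 1, 0)"
    unfolding pd_x_def by (intro DERIV_imp_deriv chain) (auto intro!: derivative_intros)
  moreover have "pd_u f (a r) (y r) (w r) = f' (0, 0, 1)"
    unfolding pd_u_def by (intro DERIV_imp_deriv chain) (auto intro!: derivative_intros)
  moreover have "f' (a', y', w') = f' (1, 0, 0) * a' + f' (0, 1, 0) * y' + f' (0, 0, 1) * w'"
  proof -
    have "(a', y', w') = a' *\<^sub>R (1, 0, 0) + y' *\<^sub>R (0, 1, 0) + w' *\<^sub>R (0, 0, 1)" by simp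
    then have "f' (a', y', w') = f' (a' *\<^sub>R (1, 0, 0) + y' *\<^sub>R (0, 1, 0) + w' *\<^sub>R (0, 0, 1))"
      by (rule arg_cong)
    also have "\<dots> = f' (1, 0, 0) * a' + f' (0, 1, 0) * y' + f' (0, 0, 1) * w'"
      by (simp only: f'.add f'.scaleR real_scaleR_def mult.commute)
    finally show ?thesis .
  qed
  ultimately show ?thesis using chain[OF a y w] by simp
qed

lemma derivatives_eq_along_sequence:
  fixes f g :: "real \<Rightarrow> real"
  assumes "(f has_real_derivative D) (at r)" "(g has_real_derivative D') (at r)"
    and "z \<longlonglongrightarrow> r" "\<And>n :: nat. z n \<noteq> r" "f r = g r" "\<And>n. f (z n) = g (z n)"
  shows "D = D'"
proof -
  have z: "filterlim z (at r) sequentially"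
    using assms(3,4) by (simp add: filterlim_at)
  have "(\<lambda>n. (f (z n) - f r) / (z n - r)) \<longlonglongrightarrow> D"
    using filterlim_compose[OF _ z] assms(1) by (fastforce simp: has_field_derivative_iff)
  moreover have "(\<lambda>n. (f (z n) - f r) / (z n - r)) \<longlonglongrightarrow> D'"
    using filterlim_compose[OF _ z] assms(2,5,6) by (fastforce simp: has_field_derivative_iff)
  ultimately show ?thesis by (rule LIMSEQ_unique)
qed

section \<open>Invariance\<close>

text \<open>
  Pulled back to \<open>S\<close>, the equality of the two integrals up to every point is an equality of
  integrands, at all points where the pre-antiderivatives are differentiable.
\<close>

lemma integrand_of_equal_delta_integrals:
  assumes "closed S" "a \<in> S" "b \<in> S" "S \<subseteq> {a..b}"
    and "strict_mono_on S \<alpha>" "continuous_on S \<alpha>" "closed (\<alpha> ` S)"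
    and int: "\<forall>\<beta>\<in>S. \<exists>A. has_delta_integral (\<alpha> ` S) f (\<alpha> a) (\<alpha> \<beta>) A \<and> has_delta_integral S g a \<beta> A"
  shows "\<exists>N. countable N \<and> (\<forall>t\<in>N. t \<in> S \<longrightarrow> \<not> right_scattered S t) \<and>
    (\<forall>t\<in>S - N. \<forall>D. t < b \<longrightarrow> has_delta_derivative S \<alpha> D t \<longrightarrow> f (\<alpha> t) * D = g t)"
proof -
  have mono: "\<alpha> r \<le> \<alpha> t" if "r \<in> S" "t \<in> S" "r \<le> t" for r t
    using that assms(5) by (metis strict_mono_on_leD)
  obtain A where A: "has_delta_integral (\<alpha> ` S) f (\<alpha> a) (\<alpha> b) A" "has_delta_integral S g a b A"
    using int assms(3) by blast
  have Sab: "S \<inter> {a..b} = S" "\<alpha> ` S \<inter> {\<alpha> a..\<alpha> b} = \<alpha> ` S" using assms(2-4) mono by auto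
  obtain F N1 where F: "countable N1" "continuous_on (\<alpha> ` S) F"
    "\<forall>t\<in>N1. \<not> right_scattered (\<alpha> ` S) t"
    "\<forall>t\<in>kappa (\<alpha> ` S) - N1. has_delta_derivative (\<alpha> ` S) F (f t) t"
    using A(1) unfolding has_delta_integral_def Sab by blast
  obtain G N2 where G: "countable N2" "continuous_on S G" "\<forall>t\<in>N2. \<not> right_scattered S t"
    "\<forall>t\<in>kappa S - N2. has_delta_derivative S G (g t) t"
    using A(2) unfolding has_delta_integral_def Sab by blast
  have incr: "F (\<alpha> \<beta>) - F (\<alpha> a) = G \<beta> - G a" if \<beta>: "\<beta> \<in> S" for \<beta>
  proof -
    obtain B where B: "has_delta_integral (\<alpha> ` S) f (\<alpha> a) (\<alpha> \<beta>) B" "has_delta_integral S g a \<beta> B"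
      using int \<beta> by blast
    have "B = F (\<alpha> \<beta>) - F (\<alpha> a)"
      by (rule has_delta_integral_eq_increment[OF assms(7) _ _ _ F(2,1) _ _ B(1)])
        (use F(3,4) assms(2,4) \<beta> mono in auto)
    moreover have "B = G \<beta> - G a"
      by (rule has_delta_integral_eq_increment[OF assms(1) _ _ _ G(2,1) _ _ B(2)])
        (use G(3,4) assms(2,4) \<beta> in auto)
    ultimately show ?thesis by simp
  qed
  let ?N = "{t\<in>S. \<alpha> t \<in> N1} \<union> N2"
  have "inj_on \<alpha> {t\<in>S. \<alpha> t \<in> N1}"
    using strict_mono_on_imp_inj_on[OF assms(5)] by (rule inj_on_subset) auto
  moreover have "countable (\<alpha> ` {t\<in>S. \<alpha> t \<in> N1})"
    using F(1) by (rule countable_subset[rotated]) auto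
  ultimately have "countable {t\<in>S. \<alpha> t \<in> N1}" using countable_image_inj_on by blast
  then have "countable ?N" using G(1) by simp
  moreover have "\<not> right_scattered S t" if "t \<in> ?N" "t \<in> S" for t
    using that F(3) G(3) right_scattered_image[OF assms(1) that(2) assms(5,6)] by auto
  moreover have "f (\<alpha> t) * D = g t"
    if t: "t \<in> S - ?N" "t < b" and D: "has_delta_derivative S \<alpha> D t" for t D
  proof -
    have tS: "t \<in> S" using t by simp
    have "\<alpha> t < \<alpha> b" using assms(3,5) tS t(2) by (auto simp: strict_mono_on_def)
    then have "\<alpha> t \<in> kappa (\<alpha> ` S)" using less_in_kappa[of "\<alpha> t" "\<alpha> ` S" "\<alpha> b"] tS assms(3) by simp
    then have "has_delta_derivative (\<alpha> ` S) F (f (\<alpha> t)) (\<alpha> t)" using F(4) t by simp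
    then have "has_delta_derivative S (\<lambda>t. F (\<alpha> t)) (f (\<alpha> t) * D) t"
      using has_delta_derivative_compose[OF assms(1) tS assms(5,6)] D by blast
    then have "has_delta_derivative S (\<lambda>t. F (\<alpha> t) + (G a - F (\<alpha> a))) (f (\<alpha> t) * D + 0) t"
      by (intro has_delta_derivative_add has_delta_derivative_const tS)
    moreover have "F (\<alpha> r) + (G a - F (\<alpha> a)) = G r" if "r \<in> S" for r using incr[OF that] by simp
    ultimately have "has_delta_derivative S G (f (\<alpha> t) * D) t"
      using has_delta_derivative_cong[OF assms(1) tS, of "\<lambda>t. F (\<alpha> t) + (G a - F (\<alpha> a))" G] by simp
    moreover have "has_delta_derivative S G (g t) t"
      using G(4) t less_in_kappa[OF tS assms(3) t(2)] by simp
    ultimately show ?thesis using has_delta_derivative_unique[OF tS assms(3) t(2)] by blast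
  qed
  ultimately show ?thesis by (intro exI[of _ ?N]) blast
qed

text \<open>
  The dynamics on the image time scale, pulled back by the chain rule. Right-scattered points are
  not exceptional because \<open>\<alpha>\<close> preserves them.
\<close>

lemma delta_derivative_of_transformed_state:
  assumes "closed S" "strict_mono_on S \<alpha>" "continuous_on S \<alpha>" "admissible \<phi> (\<alpha> ` S) y v"
  shows "\<exists>N. finite N \<and> (\<forall>t\<in>N. \<not> right_scattered S t) \<and>
    (\<forall>t\<in>S - N. \<forall>D. (\<exists>r\<in>S. t < r) \<longrightarrow> has_delta_derivative S \<alpha> D t \<longrightarrow>
       has_delta_derivative S (\<lambda>t. y (\<alpha> t)) (\<phi> (\<alpha> t) (y (\<alpha> t)) (v (\<alpha> t)) * D) t)"
proof -
  have "C1_prd (\<alpha> ` S) y" using assms(4) by (simp add: admissible_def)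
  then obtain E where E: "finite E" "\<And>t. t \<in> E \<Longrightarrow> \<not> right_scattered (\<alpha> ` S) t"
    "\<And>t. t \<in> kappa (\<alpha> ` S) \<Longrightarrow> t \<notin> E \<Longrightarrow> delta_differentiable (\<alpha> ` S) y t"
    by (rule C1_prd_differentiable) blast
  let ?N = "{t\<in>S. \<alpha> t \<in> E}"
  have "inj_on \<alpha> ?N"
    using strict_mono_on_imp_inj_on[OF assms(2)] by (rule inj_on_subset) auto
  moreover have "finite (\<alpha> ` ?N)" using E(1) by (rule finite_subset[rotated]) auto
  ultimately have "finite ?N" using finite_imageD by blast
  moreover have "\<not> right_scattered S t" if "t \<in> ?N" for t
    using that E(2) right_scattered_image[OF assms(1) _ assms(2,3)] by auto
  moreover have "has_delta_derivative S (\<lambda>t. y (\<alpha> t)) (\<phi> (\<alpha> t) (y (\<alpha> t)) (v (\<alpha> t)) * D) t"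
    if t: "t \<in> S - ?N" and r: "r \<in> S" "t < r" and D: "has_delta_derivative S \<alpha> D t" for t r D
  proof -
    have tS: "t \<in> S" using t by simp
    have "\<alpha> t < \<alpha> r" using assms(2) tS r by (auto simp: strict_mono_on_def)
    then have k: "\<alpha> t \<in> kappa (\<alpha> ` S)" using less_in_kappa[of "\<alpha> t" "\<alpha> ` S" "\<alpha> r"] tS r by simp
    obtain D' where D': "has_delta_derivative (\<alpha> ` S) y D' (\<alpha> t)"
      using E(3)[OF k] t by (auto simp: delta_differentiable_def)
    then have "D' = \<phi> (\<alpha> t) (y (\<alpha> t)) (v (\<alpha> t))"
      using assms(4) k by (simp add: admissible_def)
    then show ?thesis
      using has_delta_derivative_compose[OF assms(1) tS assms(2,3) D' D] by simp
  qed
  ultimately show ?thesis by (intro exI[of _ ?N]) blast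
qed

theorem theorem4p2:
  fixes T :: "real set" and a b \<epsilon> \<Lambda> :: real
    and L \<phi> :: "real \<Rightarrow> real \<Rightarrow> real \<Rightarrow> real"
    and ht hx \<Phi> :: "real \<Rightarrow> real \<Rightarrow> real \<Rightarrow> real \<Rightarrow> real"
    and x u p pk :: "real \<Rightarrow> real"
  assumes "time_scale T" and "a \<in> T" and "b \<in> T" and "a < b"
    and "regular_problem L \<phi> (ts_interval T a b)"
    and "\<epsilon> > 0"
    and "transformation_family \<phi> (ts_interval T a b) \<epsilon> ht hx"
    and "invariant_up_to L \<phi> (ts_interval T a b) a \<epsilon> ht hx \<Phi>"
    and "extremal L \<phi> (ts_interval T a b) x u \<Lambda> p"
    and "time_costate L \<phi> (ts_interval T a b) x u \<Lambda> p pk"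
  shows "(\<forall>t\<in>kappa (ts_interval T a b).
            has_delta_derivative (ts_interval T a b)
              (\<lambda>t. pk t * deriv (\<lambda>s. ht s t (x t) (u t)) 0
                 + p t * deriv (\<lambda>s. hx s t (x t) (u t)) 0
                 + \<Lambda> * deriv (\<lambda>s. \<Phi> s t (x t) (u t)) 0) 0 t) \<and>
         ((\<forall>t\<in>kappa (ts_interval T a b).
             bwd (ts_interval T a b) (fwd (ts_interval T a b) t) = t) \<longrightarrow>
          (\<exists>c. \<forall>t\<in>fwd (ts_interval T a b) ` kappa (ts_interval T a b).
             - hamiltonian L \<phi> (ts_interval T a b) x u \<Lambda> p (bwd (ts_interval T a b) t)
                 * deriv (\<lambda>s. ht s t (x t) (u t)) 0
               + p t * deriv (\<lambda>s. hx s t (x t) (u t)) 0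
               + \<Lambda> * deriv (\<lambda>s. \<Phi> s t (x t) (u t)) 0 = c))"
proof -
  define S where "S = ts_interval T a b"
  have S: "closed S" "a \<in> S" "b \<in> S" "S \<subseteq> {a..b}"
    using assms(1-4) by (auto simp: S_def time_scale_def)
  have adm: "admissible \<phi> S x u" and C1p: "C1_prd S p"
    using assms(9) by (simp_all add: extremal_def S_def)
  have C1pk: "C1_prd S pk" using assms(10) by (simp add: time_costate_def S_def)
  define \<alpha> where "\<alpha> = (\<lambda>s t. ht s t (x t) (u t))"
  define \<zeta> where "\<zeta> = (\<lambda>s t. hx s t (x t) (u t))"
  define \<Psi> where "\<Psi> = (\<lambda>s t. \<Phi> s t (x t) (u t))"
  define y where "y = transformed_state S ht hx x u"
  have sm_\<alpha>: "smooth_family S \<epsilon> \<alpha>" and sm_\<zeta>: "smooth_family S \<epsilon> \<zeta>"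
    and mono: "\<forall>s\<in>{-\<epsilon><..<\<epsilon>}. strict_mono_on S (\<alpha> s)"
    and img: "\<forall>s\<in>{-\<epsilon><..<\<epsilon>}. closed (\<alpha> s ` S)"
    and h0: "\<forall>t\<in>S. \<alpha> 0 t = t \<and> \<zeta> 0 t = x t"
    using assms(7) adm unfolding transformation_family_def \<alpha>_def \<zeta>_def S_def[symmetric] time_scale_def
    by blast+
  have \<alpha>_cont: "\<forall>s\<in>{-\<epsilon><..<\<epsilon>}. continuous_on S (\<alpha> s)"
    using sm_\<alpha> unfolding smooth_family_def by blast
  have sm_\<Psi>: "smooth_family S \<epsilon> \<Psi>"
    using assms(8) adm unfolding invariant_up_to_def \<Psi>_def S_def[symmetric] by blast
  obtain v :: "real \<Rightarrow> real \<Rightarrow> real" where v0: "\<forall>t\<in>kappa S. v 0 t = u t"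
    and v_adm: "\<forall>s\<in>{-\<epsilon><..<\<epsilon>}. admissible \<phi> (\<alpha> s ` S) (y s) (v s)"
    and v_int: "\<forall>s\<in>{-\<epsilon><..<\<epsilon>}. \<forall>\<beta>\<in>S. \<exists>A.
          has_delta_integral (\<alpha> s ` S) (\<lambda>ts. L ts (y s ts) (v s ts)) (\<alpha> s a) (\<alpha> s \<beta>) A \<and>
          has_delta_integral S (\<lambda>t. L t (x t) (u t) + delta_deriv S (\<Psi> s) t) a \<beta> A"
    and v_diff: "\<forall>s\<in>{-\<epsilon><..<\<epsilon>}. \<forall>t\<in>kappa S. (\<lambda>r. v r (\<alpha> r t)) differentiable (at s)"
    using assms(8)[unfolded invariant_up_to_def Let_def, folded S_def, THEN spec, THEN spec,
        THEN mp, OF adm, THEN conjunct2, folded y_def, unfolded ball_conj_distrib]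
    by (elim exE conjE) (rule that[unfolded \<alpha>_def \<Psi>_def]; assumption)
  have y_\<alpha>: "y s (\<alpha> s t) = \<zeta> s t" if "s \<in> {-\<epsilon><..<\<epsilon>}" "t \<in> S" for s t
  proof -
    have "inj_on (\<alpha> s) S" using mono that strict_mono_on_imp_inj_on by blast
    then have "the_inv_into S (\<alpha> s) (\<alpha> s t) = t" using that(2) by (rule the_inv_into_f_f)
    then show ?thesis by (simp add: y_def transformed_state_def Let_def \<alpha>_def \<zeta>_def)
  qed
  note var_\<alpha> = smooth_family_variation[OF S(1) assms(6) sm_\<alpha>]
  note var_\<zeta> = smooth_family_variation[OF S(1) assms(6) sm_\<zeta>]
  note var_\<Psi> = smooth_family_variation[OF S(1) assms(6) sm_\<Psi>]
  define \<tau> where "\<tau> t = deriv (\<lambda>s. \<alpha> s t) 0" for t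
  define \<xi> where "\<xi> t = deriv (\<lambda>s. \<zeta> s t) 0" for t
  define \<psi> where "\<psi> t = deriv (\<lambda>s. \<Psi> s t) 0" for t
  obtain E1 where E1: "finite E1" "\<forall>t\<in>E1. \<not> right_scattered S t"
    "\<forall>t\<in>kappa S - E1. (\<exists>r\<in>S. t < r) \<longrightarrow>
        (\<exists>D. (\<forall>s\<in>{-\<epsilon><..<\<epsilon>}. has_delta_derivative S (\<alpha> s) (delta_deriv S (\<alpha> s) t) t) \<and>
             ((\<lambda>s. delta_deriv S (\<alpha> s) t) has_real_derivative D) (at 0) \<and>
             has_delta_derivative S \<tau> D t)"
    using var_\<alpha>(3) unfolding \<tau>_def by blast
  obtain E2 where E2: "finite E2" "\<forall>t\<in>E2. \<not> right_scattered S t"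
    "\<forall>t\<in>kappa S - E2. (\<exists>r\<in>S. t < r) \<longrightarrow>
        (\<exists>D. (\<forall>s\<in>{-\<epsilon><..<\<epsilon>}. has_delta_derivative S (\<zeta> s) (delta_deriv S (\<zeta> s) t) t) \<and>
             ((\<lambda>s. delta_deriv S (\<zeta> s) t) has_real_derivative D) (at 0) \<and>
             has_delta_derivative S \<xi> D t)"
    using var_\<zeta>(3) unfolding \<xi>_def by blast
  obtain E3 where E3: "finite E3" "\<forall>t\<in>E3. \<not> right_scattered S t"
    "\<forall>t\<in>kappa S - E3. (\<exists>r\<in>S. t < r) \<longrightarrow>
        (\<exists>D. (\<forall>s\<in>{-\<epsilon><..<\<epsilon>}. has_delta_derivative S (\<Psi> s) (delta_deriv S (\<Psi> s) t) t) \<and>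
             ((\<lambda>s. delta_deriv S (\<Psi> s) t) has_real_derivative D) (at 0) \<and>
             has_delta_derivative S \<psi> D t)"
    using var_\<Psi>(3) unfolding \<psi>_def by blast
  obtain E4 where E4: "finite E4" "\<And>t. t \<in> E4 \<Longrightarrow> \<not> right_scattered S t"
    "\<And>t. t \<in> kappa S \<Longrightarrow> t \<notin> E4 \<Longrightarrow> delta_differentiable S p t"
    using C1p by (rule C1_prd_differentiable) blast
  obtain E5 where E5: "finite E5" "\<And>t. t \<in> E5 \<Longrightarrow> \<not> right_scattered S t"
    "\<And>t. t \<in> kappa S \<Longrightarrow> t \<notin> E5 \<Longrightarrow> delta_differentiable S pk t"
    using C1pk by (rule C1_prd_differentiable) blast
  \<comment> \<open>The exceptional points of the invariance condition depend on the parameter, so it is only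
    used along a sequence of parameters, which keeps the union of these sets countable.\<close>
  define z where "z n = \<epsilon> / real (n + 2)" for n :: nat
  have z: "z n \<in> {-\<epsilon><..<\<epsilon>}" "z n \<noteq> 0" for n
  proof -
    have "0 < z n" using assms(6) by (simp add: z_def)
    moreover have "z n < \<epsilon>" using assms(6) by (simp add: z_def field_simps add_pos_nonneg)
    ultimately show "z n \<in> {-\<epsilon><..<\<epsilon>}" "z n \<noteq> 0" using assms(6) by auto
  qed
  have z_lim: "z \<longlonglongrightarrow> 0"
    using LIMSEQ_ignore_initial_segment[OF lim_const_over_n[of \<epsilon>], of 2] by (simp add: z_def[abs_def])
  define Z where "Z = insert 0 (range z)"
  have Z: "countable Z" "Z \<subseteq> {-\<epsilon><..<\<epsilon>}" using z assms(6) by (auto simp: Z_def)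
  have "\<forall>s\<in>Z. \<exists>N. countable N \<and> (\<forall>t\<in>N. t \<in> S \<longrightarrow> \<not> right_scattered S t) \<and>
     (\<forall>t\<in>S - N. t < b \<longrightarrow> t \<notin> E1 \<longrightarrow>
        delta_deriv S (\<zeta> s) t = \<phi> (\<alpha> s t) (\<zeta> s t) (v s (\<alpha> s t)) * delta_deriv S (\<alpha> s) t \<and>
        L t (x t) (u t) + delta_deriv S (\<Psi> s) t
          = L (\<alpha> s t) (\<zeta> s t) (v s (\<alpha> s t)) * delta_deriv S (\<alpha> s) t)"
  proof
    fix s assume "s \<in> Z"
    then have s: "s \<in> {-\<epsilon><..<\<epsilon>}" using Z by blast
    note \<alpha>s = bspec[OF mono s] bspec[OF \<alpha>_cont s]
    obtain N1 where N1: "finite N1" "\<forall>t\<in>N1. \<not> right_scattered S t"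
      "\<forall>t\<in>S - N1. \<forall>D. (\<exists>r\<in>S. t < r) \<longrightarrow> has_delta_derivative S (\<alpha> s) D t \<longrightarrow>
         has_delta_derivative S (\<lambda>t. y s (\<alpha> s t)) (\<phi> (\<alpha> s t) (y s (\<alpha> s t)) (v s (\<alpha> s t)) * D) t"
      using delta_derivative_of_transformed_state[OF S(1) \<alpha>s bspec[OF v_adm s]] by blast
    obtain N2 where N2: "countable N2" "\<forall>t\<in>N2. t \<in> S \<longrightarrow> \<not> right_scattered S t"
      "\<forall>t\<in>S - N2. \<forall>D. t < b \<longrightarrow> has_delta_derivative S (\<alpha> s) D t \<longrightarrow>
         L (\<alpha> s t) (y s (\<alpha> s t)) (v s (\<alpha> s t)) * D = L t (x t) (u t) + delta_deriv S (\<Psi> s) t"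
      using integrand_of_equal_delta_integrals[OF S \<alpha>s bspec[OF img s] bspec[OF v_int s]] by blast
    have "delta_deriv S (\<zeta> s) t = \<phi> (\<alpha> s t) (\<zeta> s t) (v s (\<alpha> s t)) * delta_deriv S (\<alpha> s) t \<and>
        L t (x t) (u t) + delta_deriv S (\<Psi> s) t
          = L (\<alpha> s t) (\<zeta> s t) (v s (\<alpha> s t)) * delta_deriv S (\<alpha> s) t"
      if t: "t \<in> S" "t \<notin> N1" "t \<notin> N2" "t < b" "t \<notin> E1" for t
    proof
      have "t \<in> kappa S" using less_in_kappa t S by blast
      then have D: "has_delta_derivative S (\<alpha> s) (delta_deriv S (\<alpha> s) t) t"
        using E1(3) t s S(3) by blast
      then have "has_delta_derivative S (\<lambda>t. y s (\<alpha> s t))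
          (\<phi> (\<alpha> s t) (y s (\<alpha> s t)) (v s (\<alpha> s t)) * delta_deriv S (\<alpha> s) t) t"
        using N1(3) t S(3) by blast
      then have "has_delta_derivative S (\<zeta> s)
          (\<phi> (\<alpha> s t) (\<zeta> s t) (v s (\<alpha> s t)) * delta_deriv S (\<alpha> s) t) t"
        using has_delta_derivative_cong[OF S(1) t(1), of "\<lambda>t. y s (\<alpha> s t)" "\<zeta> s"] y_\<alpha>[OF s] t(1)
        by simp
      then show "delta_deriv S (\<zeta> s) t
          = \<phi> (\<alpha> s t) (\<zeta> s t) (v s (\<alpha> s t)) * delta_deriv S (\<alpha> s) t"
        using delta_deriv_eq[OF t(1) S(3) t(4)] by blast
      have "L (\<alpha> s t) (y s (\<alpha> s t)) (v s (\<alpha> s t)) * delta_deriv S (\<alpha> s) t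
          = L t (x t) (u t) + delta_deriv S (\<Psi> s) t"
        using N2(3) D t by blast
      then show "L t (x t) (u t) + delta_deriv S (\<Psi> s) t
          = L (\<alpha> s t) (\<zeta> s t) (v s (\<alpha> s t)) * delta_deriv S (\<alpha> s) t"
        using y_\<alpha>[OF s t(1)] by simp
    qed
    then show "\<exists>N. countable N \<and> (\<forall>t\<in>N. t \<in> S \<longrightarrow> \<not> right_scattered S t) \<and>
     (\<forall>t\<in>S - N. t < b \<longrightarrow> t \<notin> E1 \<longrightarrow>
        delta_deriv S (\<zeta> s) t = \<phi> (\<alpha> s t) (\<zeta> s t) (v s (\<alpha> s t)) * delta_deriv S (\<alpha> s) t \<and>
        L t (x t) (u t) + delta_deriv S (\<Psi> s) t
          = L (\<alpha> s t) (\<zeta> s t) (v s (\<alpha> s t)) * delta_deriv S (\<alpha> s) t)"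
      using N1(1,2) N2(1,2)
      by (intro exI[of _ "N1 \<union> N2"]) (simp add: uncountable_infinite ball_Un countable_finite)
  qed
  then obtain N where N: "\<forall>s\<in>Z. countable (N s) \<and> (\<forall>t\<in>N s. t \<in> S \<longrightarrow> \<not> right_scattered S t) \<and>
     (\<forall>t\<in>S - N s. t < b \<longrightarrow> t \<notin> E1 \<longrightarrow>
        delta_deriv S (\<zeta> s) t = \<phi> (\<alpha> s t) (\<zeta> s t) (v s (\<alpha> s t)) * delta_deriv S (\<alpha> s) t \<and>
        L t (x t) (u t) + delta_deriv S (\<Psi> s) t
          = L (\<alpha> s t) (\<zeta> s t) (v s (\<alpha> s t)) * delta_deriv S (\<alpha> s) t)"
    by (auto dest!: bchoice)
  define M where "M = (\<Union>s\<in>Z. N s) \<union> (E1 \<union> E2 \<union> E3 \<union> E4 \<union> E5)"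
  have "countable M"
    unfolding M_def using Z(1) N E1(1) E2(1) E3(1) E4(1) E5(1)
    by (intro countable_Un countable_UN) (auto intro: countable_finite)
  have M_rs: "\<not> right_scattered S t" if "t \<in> M" "t \<in> S" for t
    using that N E1(2) E2(2) E3(2) E4(2) E5(2) unfolding M_def by blast
  define C where "C t = pk t * \<tau> t + p t * \<xi> t + \<Lambda> * \<psi> t" for t
  have C_deriv: "has_delta_derivative S C 0 t" if t: "t \<in> S" "t < b" "t \<notin> M" for t
  proof -
    have tk: "t \<in> kappa S" using less_in_kappa t S by blast
    have tE: "t \<in> kappa S - E1" "t \<in> kappa S - E2" "t \<in> kappa S - E3" "t \<notin> E4" "t \<notin> E5"
      using t tk by (auto simp: M_def)
    have ex: "\<exists>r\<in>S. t < r" using t S by blast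
    let ?w = "\<lambda>s. v s (\<alpha> s t)" and ?\<sigma> = "fwd S t"
    obtain \<tau>' where \<tau>': "((\<lambda>s. delta_deriv S (\<alpha> s) t) has_real_derivative \<tau>') (at 0)"
      "has_delta_derivative S \<tau> \<tau>' t"
      using E1(3) tE ex by blast
    obtain \<xi>' where \<xi>': "((\<lambda>s. delta_deriv S (\<zeta> s) t) has_real_derivative \<xi>') (at 0)"
      "has_delta_derivative S \<xi> \<xi>' t"
      using E2(3) tE ex by blast
    obtain \<psi>' where \<psi>': "((\<lambda>s. delta_deriv S (\<Psi> s) t) has_real_derivative \<psi>') (at 0)"
      "has_delta_derivative S \<psi> \<psi>' t"
      using E3(3) tE ex by blast
    obtain w' where w': "(?w has_real_derivative w') (at 0)"
      using v_diff tk assms(6) real_differentiable_def by (meson greaterThanLessThan_iff neg_less_0_iff_less)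
    have at0: "\<alpha> 0 t = t" "\<zeta> 0 t = x t" "v 0 t = u t" using h0 t v0 tk by simp_all
    \<comment> \<open>\<open>\<alpha> 0\<close> is the identity on \<open>S\<close>\<close>
    have "delta_deriv S (\<alpha> 0) t = 1"
    proof (rule delta_deriv_eq[OF t(1) S(3) t(2)])
      show "has_delta_derivative S (\<alpha> 0) 1 t"
        using has_delta_derivative_linear[OF t(1), of 1] h0
          has_delta_derivative_cong[OF S(1) t(1), of "\<alpha> 0" "\<lambda>r. 1 * r"] by simp
    qed
    note at0 = at0 this
    note curve = var_\<alpha>(2)[OF t(1), folded \<tau>_def] var_\<zeta>(2)[OF t(1), folded \<xi>_def] w'
    have id: "delta_deriv S (\<zeta> s) t = \<phi> (\<alpha> s t) (\<zeta> s t) (?w s) * delta_deriv S (\<alpha> s) t"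
        "L t (x t) (u t) + delta_deriv S (\<Psi> s) t = L (\<alpha> s t) (\<zeta> s t) (?w s) * delta_deriv S (\<alpha> s) t"
      if "s \<in> Z" for s
    proof -
      have "t \<in> S - N s" "t \<notin> E1" using t that by (auto simp: M_def)
      then show "delta_deriv S (\<zeta> s) t = \<phi> (\<alpha> s t) (\<zeta> s t) (?w s) * delta_deriv S (\<alpha> s) t"
        "L t (x t) (u t) + delta_deriv S (\<Psi> s) t = L (\<alpha> s t) (\<zeta> s t) (?w s) * delta_deriv S (\<alpha> s) t"
        using N that t(2) by blast+
    qed
    have Z0: "0 \<in> Z" "\<And>n. z n \<in> Z" by (auto simp: Z_def)
    let ?ft = "pd_t \<phi> t (x t) (u t)" and ?fx = "pd_x \<phi> t (x t) (u t)" and ?fu = "pd_u \<phi> t (x t) (u t)"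
    let ?Lt = "pd_t L t (x t) (u t)" and ?Lx = "pd_x L t (x t) (u t)" and ?Lu = "pd_u L t (x t) (u t)"
    let ?f = "\<phi> t (x t) (u t)" and ?L = "L t (x t) (u t)"
    have diff: "(\<lambda>(t, x, u). f t x u) differentiable (at (\<alpha> 0 t, \<zeta> 0 t, ?w 0))" if "f = L \<or> f = \<phi>" for f
      using assms(5) that unfolding regular_problem_def by blast
    have rhs: "((\<lambda>s. f (\<alpha> s t) (\<zeta> s t) (?w s) * delta_deriv S (\<alpha> s) t) has_real_derivative
        pd_t f t (x t) (u t) * \<tau> t + pd_x f t (x t) (u t) * \<xi> t + pd_u f t (x t) (u t) * w'
          + f t (x t) (u t) * \<tau>') (at 0)" if "f = L \<or> f = \<phi>" for f
      using DERIV_mult[OF has_real_derivative_along_curve[OF diff[OF that] curve] \<tau>'(1)]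
      by (simp add: at0 mult.commute add.commute)
    have xi: "\<xi>' = ?ft * \<tau> t + ?fx * \<xi> t + ?fu * w' + ?f * \<tau>'"
      by (rule derivatives_eq_along_sequence[OF \<xi>'(1) rhs z_lim z(2)]) (auto intro: id Z0)
    have "((\<lambda>s. ?L + delta_deriv S (\<Psi> s) t) has_real_derivative 0 + \<psi>') (at 0)"
      by (intro DERIV_add DERIV_const \<psi>')
    then have "0 + \<psi>' = ?Lt * \<tau> t + ?Lx * \<xi> t + ?Lu * w' + ?L * \<tau>'"
      by (rule derivatives_eq_along_sequence[OF _ rhs z_lim z(2)]) (auto intro: id Z0)
    then have psi: "\<psi>' = ?Lt * \<tau> t + ?Lx * \<xi> t + ?Lu * w' + ?L * \<tau>'" by simp
    obtain Dp where Dp: "has_delta_derivative S p Dp t"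
      using E4(3)[OF tk tE(4)] by (auto simp: delta_differentiable_def)
    obtain Dpk where Dpk: "has_delta_derivative S pk Dpk t"
      using E5(3)[OF tk tE(5)] by (auto simp: delta_differentiable_def)
    have p_eq: "- Dp = ?fx * p ?\<sigma> + \<Lambda> * ?Lx" "?fu * p ?\<sigma> + \<Lambda> * ?Lu = 0"
      using assms(9) Dp tk unfolding extremal_def S_def[symmetric] by blast+
    have pk_eq: "Dpk = - \<Lambda> * ?Lt - p ?\<sigma> * ?ft" "pk ?\<sigma> + \<Lambda> * ?L + p ?\<sigma> * ?f = 0"
      using assms(10) Dpk tk unfolding time_costate_def S_def[symmetric] by blast+
    have cont: "continuous (at t within S) \<tau>" "continuous (at t within S) \<xi>"
      using var_\<alpha>(1) var_\<zeta>(1) t(1) unfolding continuous_on_eq_continuous_within \<tau>_def \<xi>_def by blast+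
    have "has_delta_derivative S C
        ((Dpk * \<tau> t + pk ?\<sigma> * \<tau>') + (Dp * \<xi> t + p ?\<sigma> * \<xi>') + \<Lambda> * \<psi>') t"
      unfolding C_def
      by (intro has_delta_derivative_add has_delta_derivative_mult has_delta_derivative_cmult
          t(1) cont Dp Dpk \<tau>' \<xi>' \<psi>')
    moreover have "(Dpk * \<tau> t + pk ?\<sigma> * \<tau>') + (Dp * \<xi> t + p ?\<sigma> * \<xi>') + \<Lambda> * \<psi>' = 0"
    proof -
      have e: "Dp = - (?fx * p ?\<sigma> + \<Lambda> * ?Lx)" "pk ?\<sigma> = - \<Lambda> * ?L - p ?\<sigma> * ?f"
        using p_eq(1) pk_eq(2) by linarith+
      then have "(Dpk * \<tau> t + pk ?\<sigma> * \<tau>') + (Dp * \<xi> t + p ?\<sigma> * \<xi>') + \<Lambda> * \<psi>'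
          = (?fu * p ?\<sigma> + \<Lambda> * ?Lu) * w'"
        unfolding xi psi pk_eq(1) e by (simp add: algebra_simps)
      then show ?thesis using p_eq(2) by simp
    qed
    ultimately show ?thesis by simp
  qed
  have C_cont: "continuous_on S C"
    unfolding C_def \<tau>_def \<xi>_def \<psi>_def
    using C1p C1pk by (intro continuous_intros var_\<alpha>(1) var_\<zeta>(1) var_\<Psi>(1)) (auto simp: C1_prd_def)
  have C_const: "C t = C a" if "t \<in> S" for t
  proof (rule delta_derivative_zero_imp_eq[where f = C and c = a and d = t and S = S and N = M])
    show "continuous_on (S \<inter> {a..t}) C" using C_cont by (rule continuous_on_subset) auto
    fix r assume r: "r \<in> S" "a \<le> r" "r < t"
    have "t \<le> b" using that S(4) by auto
    then show "has_delta_derivative S C 0 r" if "r \<notin> M" using C_deriv r that by simp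
  qed (use S that \<open>countable M\<close> M_rs in auto)
  have "has_delta_derivative S C 0 t" if "t \<in> kappa S" for t
  proof -
    have tS: "t \<in> S" using that kappa_subset by blast
    show ?thesis
      using has_delta_derivative_cong[OF S(1) tS, of C "\<lambda>_. C a"] C_const
        has_delta_derivative_const[OF tS] by simp
  qed
  moreover have "\<exists>c. \<forall>t\<in>fwd S ` kappa S.
      - hamiltonian L \<phi> S x u \<Lambda> p (bwd S t) * \<tau> t + p t * \<xi> t + \<Lambda> * \<psi> t = c"
    if inv: "\<forall>t\<in>kappa S. bwd S (fwd S t) = t"
  proof (intro exI ballI)
    fix t' assume "t' \<in> fwd S ` kappa S"
    then obtain t where t: "t \<in> kappa S" "t' = fwd S t" by blast
    have "pk (fwd S t) + \<Lambda> * L t (x t) (u t) + p (fwd S t) * \<phi> t (x t) (u t) = 0"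
      using assms(10) t(1) unfolding time_costate_def S_def[symmetric] by blast
    then have "- hamiltonian L \<phi> S x u \<Lambda> p (bwd S t') = pk t'"
      using inv t by (simp add: hamiltonian_def)
    moreover have "t' \<in> S" using t S(1) fwd_mem kappa_subset by blast
    ultimately show "- hamiltonian L \<phi> S x u \<Lambda> p (bwd S t') * \<tau> t' + p t' * \<xi> t' + \<Lambda> * \<psi> t' = C a"
      using C_const[of t'] by (simp add: C_def)
  qed
  ultimately show ?thesis
    unfolding S_def[symmetric] C_def \<tau>_def \<xi>_def \<psi>_def \<alpha>_def \<zeta>_def \<Psi>_def by blast
qed

end
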